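(* Let $p$ be a prime and let $G$ be $\mathrm{SL}(2,q)$ or $\mathrm{PSL}(2,q)$ with $q$ a prime power. Then $G$ has a redundant Sylow $p$-subgroup if and only if $p=2$ and $q$ is not of any of the forms $2^k-1$, $2^k$, $2^k+1$ for an integer $k$.
   Context: For a finite group $G$ and a prime $p$, $G_p$ denotes the set of $p$-elements of $G$ and $\mathrm{Syl}_p(G)$ the set of Sylow $p$-subgroups of $G$. $G$ is said to have a redundant Sylow $p$-subgroup if $G_p$ is contained in the union of the members of some proper subset of $\mathrm{Syl}_p(G)$. *)

theory Defs
  imports "HOL-Computational_Algebra.Primes" "HOL-Algebra.Multiplicative_Group" "HOL-Algebra.Coset"
begin

definition p_elements :: "('g, 'b) monoid_scheme \<Rightarrow> nat \<Rightarrow> 'g set" where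
  "p_elements G p = {x \<in> carrier G. \<exists>n::nat. group.ord G x = p ^ n}"

definition Sylow_subgroups :: "('g, 'b) monoid_scheme \<Rightarrow> nat \<Rightarrow> 'g set set" where
  "Sylow_subgroups G p =
     {P. subgroup P G \<and> card P = p ^ multiplicity p (order G)}"

definition has_redundant_Sylow :: "('g, 'b) monoid_scheme \<Rightarrow> nat \<Rightarrow> bool" where
  "has_redundant_Sylow G p \<longleftrightarrow>
     (\<exists>S. S \<subset> Sylow_subgroups G p \<and> p_elements G p \<subseteq> \<Union>S)"

text \<open>SL(2,F) for a field F (type 'a): 2x2 matrices (a,b,c,d) = [[a,b],[c,d]]
  of determinant 1, under matrix multiplication.\<close>
definition mat2_mult :: "'a::field * 'a * 'a * 'a \<Rightarrow> 'a * 'a * 'a * 'a \<Rightarrow> 'a * 'a * 'a * 'a" where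
  "mat2_mult M N = (case M of (a, b, c, d) \<Rightarrow> case N of (a2, b2, c2, d2) \<Rightarrow>
     (a * a2 + b * c2, a * b2 + b * d2, c * a2 + d * c2, c * b2 + d * d2))"

definition SL2 :: "('a::field * 'a * 'a * 'a) monoid" where
  "SL2 = \<lparr> carrier = {M. case M of (a, b, c, d) \<Rightarrow> a * d - b * c = 1},
           mult = mat2_mult,
           one = (1, 0, 0, 1) \<rparr>"

definition SL2_centre :: "('a::field * 'a * 'a * 'a) set" where
  "SL2_centre = {(1, 0, 0, 1), (-1, 0, 0, -1)}"

definition PSL2 :: "('a::field * 'a * 'a * 'a) set monoid" where
  "PSL2 = SL2 Mod SL2_centre"

end

theory Submission
  imports Defs "HOL-Algebra.Sylow" "HOL-Algebra.Group_Action"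
begin

text \<open>
  By Sylow's conjugacy theorem, a group has a redundant Sylow \<open>p\<close>-subgroup iff every
  \<open>p\<close>-element lies in at least two Sylow \<open>p\<close>-subgroups. Write \<open>q = |F|\<close>. If \<open>p\<close> divides \<open>q\<close>,
  a transvection fixes a single line and so lies in a single Sylow subgroup. If \<open>p\<close> is odd and does
  not divide \<open>q\<close>, the Sylow \<open>p\<close>-subgroups are cyclic, because \<open>p\<close> divides at most one of
  \<open>q - 1\<close>, \<open>q + 1\<close> and both numbers are orders of cyclic tori of \<open>SL(2,q)\<close>; a generator of a
  cyclic Sylow subgroup lies in no other one.

  Let \<open>p = 2\<close> and \<open>q\<close> odd, let \<open>T\<close> be the cyclic torus whose order \<open>N\<close>, one of \<open>q - 1\<close> and
  \<open>q + 1\<close>, is divisible by 4, and let \<open>x\<close> generate the Sylow 2-subgroup of \<open>T\<close>, which has index 2 in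
  the Sylow 2-subgroups of \<open>SL(2,q)\<close> above it. Elements of such a Sylow subgroup \<open>P\<close> outside
  \<open>\<langle>x\<rangle>\<close> invert \<open>x\<close> and square to \<open>-1\<close>. Since all elements with square \<open>-1\<close> are conjugate, every
  2-element is conjugate into \<open>\<langle>x\<rangle>\<close>, so only \<open>x\<close> matters. If \<open>N\<close> is a power of 2, then \<open>\<langle>x\<rangle>\<close> is the
  centralizer of \<open>x\<close> and \<open>P\<close> is unique. Otherwise a nontrivial \<open>r\<close> of odd order in \<open>T\<close>
  centralizes \<open>x\<close> but does not normalize \<open>P\<close>: an element of \<open>P\<close> outside \<open>T\<close> inverts \<open>r\<close>, so
  \<open>r\<^sup>2\<close> would be an element of \<open>P\<close>.

  The passage to \<open>PSL(2,q)\<close> works because the kernel is central of order 1 or 2.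
\<close>

section \<open>Sylow subgroups of finite groups\<close>

lemma (in group_action) p_group_fixed_point:
  assumes p: "prime p" and ordG: "order G = p ^ k" and fE: "finite E" and nd: "\<not> p dvd card E"
  shows "\<exists>x\<in>E. \<forall>g\<in>carrier G. \<phi> g x = x"
proof -
  interpret group G using group_hom group_hom.axioms(1) by blast
  have part: "partition E (orbits G E \<phi>)" by (rule orbit_partition)
  have un: "\<Union>(orbits G E \<phi>) = E"
    using partition.unique_class[OF part] partition.incl[OF part] by blast
  have disj: "A \<inter> B = {}" if "A \<in> orbits G E \<phi>" "B \<in> orbits G E \<phi>" "A \<noteq> B" for A B
    using that partition.unique_class[OF part] partition.incl[OF part]
    by (metis disjoint_iff subset_eq)
  have fin: "finite A" if "A \<in> orbits G E \<phi>" for A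
    by (rule finite_subset[OF _ fE]) (use that un in blast)
  have "card E = (\<Sum>A\<in>orbits G E \<phi>. card A)"
    using card_Union_disjoint[of "orbits G E \<phi>"] un disj fin
    by (metis (no_types, lifting) disjnt_def pairwiseI)
  then obtain A where A: "A \<in> orbits G E \<phi>" "\<not> p dvd card A"
    using nd by (metis dvd_sum)
  then obtain x where x: "x \<in> E" "A = orbit G \<phi> x" by (auto simp: orbits_def)
  have "card A dvd p ^ k"
    using orbit_stabilizer_theorem[OF x(1)] x(2) ordG by (metis dvd_triv_left)
  then obtain j where "card A = p ^ j"
    using p divides_primepow_nat by blast
  then have "card A = 1" using A(2) by (cases j) auto
  then obtain y where y: "A = {y}" by (meson card_1_singletonE)
  have "\<phi> g x = x" if "g \<in> carrier G" for g
  proof -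
    have "\<phi> g x \<in> A" "x \<in> A"
      using that x orbit_refl by (auto simp: orbit_def)
    then show ?thesis using y by auto
  qed
  then show ?thesis using x(1) by blast
qed

context group
begin

lemma action_on_rcosets:
  assumes Q: "subgroup Q G" and P: "subgroup P G"
  shows "group_action (G\<lparr>carrier := Q\<rparr>) (rcosets P) (\<lambda>g. \<lambda>X\<in>rcosets P. X #> inv g)"
proof -
  interpret Qg: group "G\<lparr>carrier := Q\<rparr>" using Q by (simp add: subgroup_imp_group)
  have sub: "X \<subseteq> carrier G" if "X \<in> rcosets P" for X
    using subgroup.rcosets_carrier[OF P is_group that] .
  have cl: "X #> g \<in> rcosets P" if "X \<in> rcosets P" "g \<in> carrier G" for X g
  proof -
    obtain a where a: "a \<in> carrier G" "X = P #> a" using \<open>X \<in> rcosets P\<close> by (auto simp: RCOSETS_def)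
    have "X #> g = P #> (a \<otimes> g)"
      using a that P by (simp add: coset_mult_assoc subgroup.subset)
    then show ?thesis using a that by (auto simp: RCOSETS_def)
  qed
  have Qc: "g \<in> carrier G" if "g \<in> Q" for g using that Q by (simp add: subgroup.mem_carrier)
  have comp: "X #> g #> h = X #> (g \<otimes> h)" if "X \<in> rcosets P" "g \<in> carrier G" "h \<in> carrier G" for X g h
    using that sub coset_mult_assoc by simp
  have one: "X #> \<one> = X" if "X \<in> rcosets P" for X
    using that sub coset_mult_one by simp
  have bij: "(\<lambda>X\<in>rcosets P. X #> inv g) \<in> Bij (rcosets P)" if g: "g \<in> carrier G" for g
    unfolding Bij_def
  proof (intro IntI CollectI)
    show "(\<lambda>X\<in>rcosets P. X #> inv g) \<in> extensional (rcosets P)" by auto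
    have "bij_betw (\<lambda>X. X #> inv g) (rcosets P) (rcosets P)"
      by (rule bij_betw_byWitness[where f' = "\<lambda>X. X #> g"]) (use g in \<open>auto simp: comp one cl\<close>)
    then show "bij_betw (\<lambda>X\<in>rcosets P. X #> inv g) (rcosets P) (rcosets P)"
      by (simp cong: bij_betw_cong)
  qed
  show ?thesis
    unfolding group_action_def group_hom_def group_hom_axioms_def hom_def
  proof (intro conjI CollectI ballI)
    show "group (G\<lparr>carrier := Q\<rparr>)" by (rule Qg.is_group)
    show "group (BijGroup (rcosets P))" by (rule group_BijGroup)
    show "(\<lambda>g. \<lambda>X\<in>rcosets P. X #> inv g) \<in> carrier (G\<lparr>carrier := Q\<rparr>) \<rightarrow> carrier (BijGroup (rcosets P))"
      using bij Qc by (auto simp: BijGroup_def)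
    fix g h assume "g \<in> carrier (G\<lparr>carrier := Q\<rparr>)" "h \<in> carrier (G\<lparr>carrier := Q\<rparr>)"
    then have gh: "g \<in> carrier G" "h \<in> carrier G" using Qc by auto
    show "(\<lambda>X\<in>rcosets P. X #> inv (g \<otimes>\<^bsub>G\<lparr>carrier := Q\<rparr>\<^esub> h)) =
      (\<lambda>X\<in>rcosets P. X #> inv g) \<otimes>\<^bsub>BijGroup (rcosets P)\<^esub> (\<lambda>X\<in>rcosets P. X #> inv h)"
      using gh bij by (simp add: BijGroup_def compose_def inv_mult_group)
        (rule restrict_ext, simp add: cl comp)
  qed
qed

lemma conj_image_eq_cosets:
  assumes "g \<in> carrier G" "H \<subseteq> carrier G"
  shows "(\<lambda>x. g \<otimes> x \<otimes> inv g) ` H = g <# H #> inv g"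
  by (auto simp: l_coset_def r_coset_def)

lemma subgroup_conj_image:
  assumes "subgroup H G" "g \<in> carrier G"
  shows "subgroup ((\<lambda>x. g \<otimes> x \<otimes> inv g) ` H) G"
  using subgroup_conjugation_is_surj2[OF assms(2,1)] conj_image_eq_cosets[OF assms(2)]
    subgroup.subset[OF assms(1)] by simp

lemma card_conj_image:
  assumes "H \<subseteq> carrier G" "g \<in> carrier G"
  shows "card ((\<lambda>x. g \<otimes> x \<otimes> inv g) ` H) = card H"
  by (rule card_image) (meson assms conjugation_is_inj inj_onI subsetD)

lemma conj_Sylow:
  assumes "P \<in> Sylow_subgroups G p" "g \<in> carrier G"
  shows "(\<lambda>x. g \<otimes> x \<otimes> inv g) ` P \<in> Sylow_subgroups G p"
  using assms by (simp add: Sylow_subgroups_def subgroup_conj_image card_conj_image subgroup.subset)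

lemma inv_mult_cancel_left:
  assumes "g \<in> carrier G" "x \<in> carrier G"
  shows "inv g \<otimes> (g \<otimes> x) = x" "g \<otimes> (inv g \<otimes> x) = x"
  using assms by (simp_all flip: m_assoc)

lemma inv_conj_conj:
  assumes "g \<in> carrier G" "x \<in> carrier G"
  shows "inv g \<otimes> (g \<otimes> x \<otimes> inv g) \<otimes> g = x"
  using assms by (metis inv_closed inv_inv conjugation_is_surj)

lemma ord_conj:
  assumes "g \<in> carrier G" "x \<in> carrier G"
  shows "ord (g \<otimes> x \<otimes> inv g) = ord x"
proof -
  have "(g \<otimes> x \<otimes> inv g) [^] n = g \<otimes> x [^] n \<otimes> inv g" for n::nat
  proof (induction n)
    case (Suc n)
    then show ?case using assms by (simp add: m_assoc inv_mult_cancel_left)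
  qed (use assms in simp)
  moreover have "g \<otimes> y \<otimes> inv g = \<one> \<longleftrightarrow> y = \<one>" if "y \<in> carrier G" for y
    using conjugation_is_inj[of g y \<one>] assms that by auto
  ultimately show ?thesis
    using assms by (simp add: ord_unique pow_eq_id)
qed

lemma p_elements_conj:
  assumes "g \<in> carrier G" "x \<in> p_elements G p"
  shows "g \<otimes> x \<otimes> inv g \<in> p_elements G p"
  using assms by (auto simp: p_elements_def ord_conj)

end

locale finite_group_prime = group G for G (structure) +
  fixes p :: nat
  assumes finite_carrier: "finite (carrier G)" and prime_p: "prime p"
begin

lemma Sylow_exists: "\<exists>P. P \<in> Sylow_subgroups G p"
proof -
  have "p ^ multiplicity p (order G) dvd order G" by (rule multiplicity_dvd)
  then obtain m where "order G = p ^ multiplicity p (order G) * m" by blast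
  from sylow_thm[OF prime_p is_group this finite_carrier] show ?thesis
    by (auto simp: Sylow_subgroups_def)
qed

lemma p_subgroup_le_conj_Sylow:
  assumes P: "P \<in> Sylow_subgroups G p" and Q: "subgroup Q G" "card Q = p ^ k"
  shows "\<exists>g\<in>carrier G. Q \<subseteq> (\<lambda>x. g \<otimes> x \<otimes> inv g) ` P"
proof -
  have Ps: "subgroup P G" and Pc: "card P = p ^ multiplicity p (order G)"
    using P by (auto simp: Sylow_subgroups_def)
  interpret act: group_action "G\<lparr>carrier := Q\<rparr>" "rcosets P" "\<lambda>g. \<lambda>X\<in>rcosets P. X #> inv g"
    by (rule action_on_rcosets[OF Q(1) Ps])
  have lag: "card (rcosets P) * p ^ multiplicity p (order G) = order G"
    using lagrange[OF Ps] Pc by simp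
  have o0: "order G \<noteq> 0" using finite_carrier order_gt_0_iff_finite by auto
  have nd: "\<not> p dvd card (rcosets P)"
  proof
    assume "p dvd card (rcosets P)"
    then have "p ^ Suc (multiplicity p (order G)) dvd order G"
      using lag by (metis mult_dvd_mono dvd_refl power_Suc)
    then show False
      using o0 prime_p multiplicity_geI[of "order G" p] not_prime_unit by (metis Suc_n_not_le_n)
  qed
  have "order (G\<lparr>carrier := Q\<rparr>) = p ^ k" using Q by (simp add: order_def)
  moreover have "finite (rcosets P)"
    using finite_carrier Ps rcosets_subset_PowG by (meson finite_Pow_iff finite_subset)
  ultimately obtain X where X: "X \<in> rcosets P"
    and fixed: "\<And>g. g \<in> Q \<Longrightarrow> X #> inv g = X"
    using act.p_group_fixed_point[OF prime_p _ _ nd, of k] by auto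
  obtain a where a: "a \<in> carrier G" "X = P #> a" using X by (auto simp: RCOSETS_def)
  have "q \<in> (\<lambda>x. inv a \<otimes> x \<otimes> inv (inv a)) ` P" if q: "q \<in> Q" for q
  proof
    have qc: "q \<in> carrier G" using q Q by (simp add: subgroup.mem_carrier)
    have iq: "inv q \<in> Q" using q Q by (simp add: subgroup.m_inv_closed)
    have "P #> (a \<otimes> q) = P #> a"
      using fixed[OF iq] a qc Ps by (simp add: coset_mult_assoc subgroup.subset)
    then have "a \<otimes> q \<in> P #> a"
      using rcos_self[OF _ Ps, of "a \<otimes> q"] a qc by simp
    then show "a \<otimes> q \<otimes> inv a \<in> P"
      using a qc subgroup.rcos_module_imp[OF Ps is_group] by simp
    show "q = inv a \<otimes> (a \<otimes> q \<otimes> inv a) \<otimes> inv (inv a)"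
      using inv_conj_conj[OF a(1) qc] a by simp
  qed
  then show ?thesis using a by (meson inv_closed subsetI)
qed

lemma Sylow_conj:
  assumes P: "P \<in> Sylow_subgroups G p" and Q: "Q \<in> Sylow_subgroups G p"
  shows "\<exists>g\<in>carrier G. Q = (\<lambda>x. g \<otimes> x \<otimes> inv g) ` P"
proof -
  obtain g where g: "g \<in> carrier G" "Q \<subseteq> (\<lambda>x. g \<otimes> x \<otimes> inv g) ` P"
    using p_subgroup_le_conj_Sylow[OF P, of Q "multiplicity p (order G)"] Q
    by (auto simp: Sylow_subgroups_def)
  have "(\<lambda>x. g \<otimes> x \<otimes> inv g) ` P \<in> Sylow_subgroups G p"
    using conj_Sylow[OF P g(1)] .
  then have "card ((\<lambda>x. g \<otimes> x \<otimes> inv g) ` P) = card Q" "(\<lambda>x. g \<otimes> x \<otimes> inv g) ` P \<subseteq> carrier G"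
    using Q subgroup.subset by (auto simp: Sylow_subgroups_def)
  then show ?thesis using g finite_carrier
    by (metis card_subset_eq finite_subset)
qed

lemma p_element_in_Sylow:
  assumes "x \<in> p_elements G p"
  shows "\<exists>P\<in>Sylow_subgroups G p. x \<in> P"
proof -
  obtain n where x: "x \<in> carrier G" "ord x = p ^ n" using assms by (auto simp: p_elements_def)
  obtain P where P: "P \<in> Sylow_subgroups G p" using Sylow_exists by blast
  have "subgroup (generate G {x}) G" using x by (simp add: generate_is_subgroup)
  moreover have "card (generate G {x}) = p ^ n" using x by (simp flip: generate_pow_card)
  ultimately obtain g where "g \<in> carrier G" "generate G {x} \<subseteq> (\<lambda>x. g \<otimes> x \<otimes> inv g) ` P"
    using p_subgroup_le_conj_Sylow[OF P] by blast
  moreover have "x \<in> generate G {x}" by (simp add: generate.incl)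
  ultimately show ?thesis using conj_Sylow[OF P] by blast
qed

lemma Sylow_subset_p_elements:
  assumes "P \<in> Sylow_subgroups G p"
  shows "P \<subseteq> p_elements G p"
proof
  fix x assume x: "x \<in> P"
  have P: "subgroup P G" "card P = p ^ multiplicity p (order G)"
    using assms by (auto simp: Sylow_subgroups_def)
  have xc: "x \<in> carrier G" by (rule subgroup.mem_carrier[OF P(1) x])
  interpret H: group "G\<lparr>carrier := P\<rparr>" using P by (simp add: subgroup_imp_group)
  have "x [^] card P = \<one>"
    using H.pow_order_eq_1[of x] x by (simp add: order_def flip: nat_pow_consistent)
  then have "ord x dvd p ^ multiplicity p (order G)" using xc P by (simp add: pow_eq_id)
  then show "x \<in> p_elements G p"
    using xc prime_p divides_primepow_nat by (auto simp: p_elements_def)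
qed

lemma not_redundant_if_unique:
  assumes x: "x \<in> p_elements G p" and P: "P \<in> Sylow_subgroups G p"
    and uniq: "\<And>Q. Q \<in> Sylow_subgroups G p \<Longrightarrow> x \<in> Q \<Longrightarrow> Q = P"
  shows "\<not> has_redundant_Sylow G p"
proof
  assume "has_redundant_Sylow G p"
  then obtain S where S: "S \<subset> Sylow_subgroups G p" "p_elements G p \<subseteq> \<Union>S"
    by (auto simp: has_redundant_Sylow_def)
  then obtain Q where Q: "Q \<in> Sylow_subgroups G p" "Q \<notin> S" by blast
  obtain g where g: "g \<in> carrier G" "Q = (\<lambda>x. g \<otimes> x \<otimes> inv g) ` P"
    using Sylow_conj[OF P Q(1)] by blast
  have xc: "x \<in> carrier G" using x by (simp add: p_elements_def)
  have "g \<otimes> x \<otimes> inv g \<in> p_elements G p" using p_elements_conj g x by simp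
  then obtain R where R: "R \<in> S" "g \<otimes> x \<otimes> inv g \<in> R" using S by blast
  have Rs: "R \<in> Sylow_subgroups G p" using R S by blast
  have "x \<in> (\<lambda>x. inv g \<otimes> x \<otimes> inv (inv g)) ` R"
    using R(2) inv_conj_conj[OF g(1) xc] g(1) by (metis image_eqI inv_inv)
  then have *: "(\<lambda>x. inv g \<otimes> x \<otimes> inv (inv g)) ` R = P"
    using uniq conj_Sylow[OF Rs, of "inv g"] g by simp
  have "R \<subseteq> carrier G" using Rs subgroup.subset by (auto simp: Sylow_subgroups_def)
  then have "(\<lambda>x. g \<otimes> x \<otimes> inv g) ` (\<lambda>x. inv g \<otimes> x \<otimes> inv (inv g)) ` R = R"
    using conjugation_is_surj[OF g(1)] g(1) by (force simp: image_image subset_eq)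
  then show False using * g(2) Q(2) R(1) by simp
qed

lemma redundant_if_no_unique:
  assumes "\<And>x. x \<in> p_elements G p \<Longrightarrow>
    \<exists>P\<in>Sylow_subgroups G p. \<exists>Q\<in>Sylow_subgroups G p. P \<noteq> Q \<and> x \<in> P \<and> x \<in> Q"
  shows "has_redundant_Sylow G p"
proof -
  obtain P where P: "P \<in> Sylow_subgroups G p" using Sylow_exists by blast
  show ?thesis unfolding has_redundant_Sylow_def
  proof (intro exI conjI)
    show "Sylow_subgroups G p - {P} \<subset> Sylow_subgroups G p" using P by blast
    show "p_elements G p \<subseteq> \<Union>(Sylow_subgroups G p - {P})"
      using assms by blast
  qed
qed

lemma redundant_iff:
  "has_redundant_Sylow G p \<longleftrightarrow> (\<forall>x\<in>p_elements G p.
    \<exists>P\<in>Sylow_subgroups G p. \<exists>Q\<in>Sylow_subgroups G p. P \<noteq> Q \<and> x \<in> P \<and> x \<in> Q)"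
  using redundant_if_no_unique not_redundant_if_unique p_element_in_Sylow by metis

lemma not_redundant_if_cyclic_Sylow:
  assumes x: "x \<in> carrier G" "ord x = p ^ multiplicity p (order G)"
  shows "\<not> has_redundant_Sylow G p"
proof (rule not_redundant_if_unique)
  show "x \<in> p_elements G p" using x by (auto simp: p_elements_def)
  have s: "subgroup (generate G {x}) G" using x by (simp add: generate_is_subgroup)
  have c: "card (generate G {x}) = p ^ multiplicity p (order G)" using x by (simp flip: generate_pow_card)
  show "generate G {x} \<in> Sylow_subgroups G p" using s c by (simp add: Sylow_subgroups_def)
  fix Q assume Q: "Q \<in> Sylow_subgroups G p" "x \<in> Q"
  then have "generate G {x} \<subseteq> Q"
    by (intro generate_subgroup_incl) (auto simp: Sylow_subgroups_def)
  moreover have "finite Q" using Q finite_carrier subgroup.subset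
    by (metis (mono_tags, lifting) Sylow_subgroups_def finite_subset mem_Collect_eq)
  ultimately show "Q = generate G {x}"
    using c Q card_subset_eq by (metis (mono_tags, lifting) Sylow_subgroups_def mem_Collect_eq)
qed

end

section \<open>Central quotients\<close>

lemma (in group_hom) order_eq_card_kernel_mult:
  assumes surj: "h ` carrier G = carrier H"
  shows "order G = order H * card (kernel G H h)"
proof -
  have "card (carrier (G Mod kernel G H h)) = card (carrier H)"
    using FactGroup_iso_set[OF surj] by (auto simp: iso_def dest: bij_betw_same_card)
  then show ?thesis
    using G.lagrange[OF subgroup_kernel] by (simp add: FactGroup_def order_def)
qed

lemma (in group_hom) card_subgroup_eq:
  assumes P: "subgroup P G"
  shows "card P = card (h ` P) * card (kernel G H h \<inter> P)"
proof -
  have gP: "group (G\<lparr>carrier := P\<rparr>)" using P by (simp add: G.subgroup_imp_group)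
  have gH: "group (H\<lparr>carrier := h ` P\<rparr>)"
    using subgroup_img_is_subgroup[OF P] by (simp add: H.subgroup_imp_group)
  interpret r: group_hom "G\<lparr>carrier := P\<rparr>" "H\<lparr>carrier := h ` P\<rparr>" h
    using gP gH subgroup.subset[OF P]
    by (auto simp: group_hom_def group_hom_axioms_def hom_def subset_eq)
  have "kernel (G\<lparr>carrier := P\<rparr>) (H\<lparr>carrier := h ` P\<rparr>) h = kernel G H h \<inter> P"
    using subgroup.subset[OF P] by (auto simp: kernel_def)
  then show ?thesis
    using r.order_eq_card_kernel_mult by (simp add: order_def)
qed

locale central_epi = group_hom G H h + finite_group_prime G p
  for G (structure) and H (structure) and h and p +
  assumes surj: "h ` carrier G = carrier H"
    and central: "k \<in> kernel G H h \<Longrightarrow> g \<in> carrier G \<Longrightarrow> k \<otimes> g = g \<otimes> k"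
begin

lemma finite_H: "finite (carrier H)"
  using surj finite_carrier by (metis finite_imageI)

sublocale H: finite_group_prime H p
  by unfold_locales (auto simp: finite_H prime_p)

lemma image_Sylow:
  assumes P: "P \<in> Sylow_subgroups G p"
  shows "h ` P \<in> Sylow_subgroups H p"
proof -
  let ?K = "kernel G H h"
  have Ps: "subgroup P G" and Pc: "card P = p ^ multiplicity p (order G)"
    using P by (auto simp: Sylow_subgroups_def)
  have hPs: "subgroup (h ` P) H" by (rule subgroup_img_is_subgroup[OF Ps])
  have fP: "finite P" using subgroup.subset[OF Ps] finite_carrier finite_subset by blast
  have c1: "card P = card (h ` P) * card (?K \<inter> P)" by (rule card_subgroup_eq[OF Ps])
  then obtain a where a: "card (h ` P) = p ^ a"
    using Pc prime_p divides_primepow_nat by (metis dvd_triv_left)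
  have oG: "order G \<noteq> 0" using finite_carrier G.order_gt_0_iff_finite by auto
  then obtain n where n: "order G = card P * n" "\<not> p dvd n"
    using Pc prime_p multiplicity_decompose'[of "order G" p] not_prime_unit by metis
  obtain m where m: "order H = card (h ` P) * m"
    using H.lagrange[OF hPs] by (metis mult.commute)
  have KP: "subgroup (?K \<inter> P) (G\<lparr>carrier := ?K\<rparr>)"
    using subgroup_kernel Ps G.subgroups_Inter_pair
    by (metis G.subgroup_incl Int_lower1)
  obtain l where l: "card ?K = card (?K \<inter> P) * l"
    using group.lagrange[OF G.subgroup_imp_group[OF subgroup_kernel] KP]
    by (metis mult.commute order_def partial_object.select_convs(1) partial_object.update_convs(1) partial_object.surjective)
  have "card P * n = card P * (m * l)"
    using n m l c1 order_eq_card_kernel_mult[OF surj] by (metis mult.assoc mult.commute)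
  moreover have "card P > 0" using fP subgroup.one_closed[OF Ps] card_gt_0_iff by auto
  ultimately have "\<not> p dvd m" using n by auto
  then have "multiplicity p (order H) = a"
    using a m prime_p by (intro multiplicity_eqI) (auto simp: mult_ac prime_gt_0_nat)
  then show ?thesis using hPs a by (simp add: Sylow_subgroups_def)
qed

lemma Sylow_H_is_image:
  assumes Q: "Q \<in> Sylow_subgroups H p"
  obtains P where "P \<in> Sylow_subgroups G p" "Q = h ` P"
proof -
  obtain P where P: "P \<in> Sylow_subgroups G p" using Sylow_exists by blast
  obtain y where y: "y \<in> carrier H" "Q = (\<lambda>x. y \<otimes>\<^bsub>H\<^esub> x \<otimes>\<^bsub>H\<^esub> inv\<^bsub>H\<^esub> y) ` h ` P"
    using H.Sylow_conj[OF image_Sylow[OF P] Q] by blast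
  obtain g where g: "g \<in> carrier G" "y = h g" using y surj by blast
  have "P \<subseteq> carrier G" using P subgroup.subset by (auto simp: Sylow_subgroups_def)
  then have "Q = h ` (\<lambda>x. g \<otimes> x \<otimes> inv g) ` P"
    using y(2) g by (auto simp: image_image subset_eq intro!: image_cong)
  then show ?thesis using that G.conj_Sylow[OF P g(1)] by blast
qed

lemma image_p_elements: "h ` p_elements G p = p_elements H p"
proof
  show "h ` p_elements G p \<subseteq> p_elements H p"
  proof
    fix y assume "y \<in> h ` p_elements G p"
    then obtain x n where x: "x \<in> carrier G" "G.ord x = p ^ n" "y = h x"
      by (auto simp: p_elements_def)
    have "y [^]\<^bsub>H\<^esub> (p ^ n) = \<one>\<^bsub>H\<^esub>"
      using x by (metis G.pow_ord_eq_1 hom_nat_pow hom_one)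
    then have "H.ord y dvd p ^ n" using x by (simp add: H.pow_eq_id)
    then show "y \<in> p_elements H p"
      using x prime_p divides_primepow_nat by (auto simp: p_elements_def)
  qed
  show "p_elements H p \<subseteq> h ` p_elements G p"
  proof
    fix y assume "y \<in> p_elements H p"
    then obtain Q where Q: "Q \<in> Sylow_subgroups H p" "y \<in> Q"
      using H.p_element_in_Sylow by blast
    then obtain P where "P \<in> Sylow_subgroups G p" "Q = h ` P" using Sylow_H_is_image by blast
    then show "y \<in> h ` p_elements G p" using Q Sylow_subset_p_elements by blast
  qed
qed

lemma kernel_subset_Sylow:
  assumes K: "card (kernel G H h) = p ^ b" and Q: "Q \<in> Sylow_subgroups G p"
  shows "kernel G H h \<subseteq> Q"
proof
  fix k assume k: "k \<in> kernel G H h"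
  obtain g where g: "g \<in> carrier G" "kernel G H h \<subseteq> (\<lambda>x. g \<otimes> x \<otimes> inv g) ` Q"
    using p_subgroup_le_conj_Sylow[OF Q subgroup_kernel K] by blast
  then obtain x where x: "x \<in> Q" "k = g \<otimes> x \<otimes> inv g" using k by blast
  have kc: "k \<in> carrier G" using k by (simp add: kernel_def)
  have xc: "x \<in> carrier G" using x(1) Q subgroup.mem_carrier by (fastforce simp: Sylow_subgroups_def)
  have "x = inv g \<otimes> k \<otimes> g" using G.inv_conj_conj[OF g(1) xc] x(2) by simp
  also have "\<dots> = k" using g(1) kc central[OF k, of "g"] by (simp add: G.m_assoc G.inv_mult_cancel_left)
  finally show "k \<in> Q" using x by simp
qed

lemma fibre_in_Sylow:
  assumes K: "\<not> p dvd card (kernel G H h) \<or> (\<exists>b. card (kernel G H h) = p ^ b)"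
    and Q: "Q \<in> Sylow_subgroups G p" and x: "x \<in> p_elements G p" "h x \<in> h ` Q"
  shows "x \<in> Q"
proof -
  let ?K = "kernel G H h"
  have Qs: "subgroup Q G" using Q by (simp add: Sylow_subgroups_def)
  obtain y where y: "y \<in> Q" "h x = h y" using x by blast
  have xc: "x \<in> carrier G" using x by (simp add: p_elements_def)
  have yc: "y \<in> carrier G" by (rule subgroup.mem_carrier[OF Qs y(1)])
  define k where "k = inv y \<otimes> x"
  have k: "k \<in> ?K" using xc yc y by (simp add: k_def kernel_def)
  have kc: "k \<in> carrier G" using xc yc by (simp add: k_def)
  have xk: "x = y \<otimes> k" using xc yc by (simp add: k_def G.inv_mult_cancel_left)
  have "k \<in> Q"
  proof (cases "\<exists>b. card ?K = p ^ b")
    case True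
    then show ?thesis using kernel_subset_Sylow[OF _ Q] k by blast
  next
    case False
    then have nd: "\<not> p dvd card ?K" using K by blast
    obtain m n where mn: "G.ord x = p ^ m" "G.ord (inv y) = p ^ n"
      using x Sylow_subset_p_elements[OF Q] y yc by (auto simp: p_elements_def)
    have "x \<otimes> inv y = k"
      using xk central[OF k yc] kc yc by (metis G.inv_closed G.m_assoc G.r_inv G.r_one)
    then have "inv y \<otimes> x = x \<otimes> inv y" by (simp add: k_def)
    then have "G.ord k dvd p ^ (n + m)"
      using G.ord_mul_divides[of "inv y" x] xc yc mn by (simp add: k_def power_add)
    then obtain j where j: "G.ord k = p ^ j" using prime_p divides_primepow_nat by blast
    interpret Kg: group "G\<lparr>carrier := ?K\<rparr>" using subgroup_kernel by (simp add: G.subgroup_imp_group)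
    have "k [^] card ?K = \<one>"
      using Kg.pow_order_eq_1[of k] k by (simp add: order_def flip: G.nat_pow_consistent)
    then have "p ^ j dvd card ?K" using j kc by (simp add: G.pow_eq_id)
    then have "j = 0" using nd by (metis dvd_power dvd_trans gr0I)
    then have "k = \<one>" using j G.ord_eq_1[OF kc] by simp
    then show ?thesis using subgroup.one_closed[OF Qs] by simp
  qed
  then show ?thesis using xk y subgroup.m_closed[OF Qs] by simp
qed

lemma not_redundant_image:
  assumes K: "\<not> p dvd card (kernel G H h) \<or> (\<exists>b. card (kernel G H h) = p ^ b)"
    and "\<not> has_redundant_Sylow G p"
  shows "\<not> has_redundant_Sylow H p"
proof -
  obtain x where x: "x \<in> p_elements G p"
    and u: "\<And>P Q. P \<in> Sylow_subgroups G p \<Longrightarrow> Q \<in> Sylow_subgroups G p \<Longrightarrow> x \<in> P \<Longrightarrow> x \<in> Q \<Longrightarrow> P = Q"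
    using assms(2) unfolding redundant_iff by blast
  have "h x \<in> p_elements H p" using x image_p_elements by blast
  moreover have "P' = Q'" if "P' \<in> Sylow_subgroups H p" "Q' \<in> Sylow_subgroups H p"
    "h x \<in> P'" "h x \<in> Q'" for P' Q'
    using that fibre_in_Sylow[OF K _ x] u by (metis Sylow_H_is_image)
  ultimately show ?thesis unfolding H.redundant_iff by blast
qed

lemma redundant_image:
  assumes K: "card (kernel G H h) = p ^ b" and r: "has_redundant_Sylow G p"
  shows "has_redundant_Sylow H p"
proof (rule H.redundant_if_no_unique)
  fix y assume "y \<in> p_elements H p"
  then obtain x where x: "x \<in> p_elements G p" "y = h x" using image_p_elements by blast
  then obtain P Q where PQ: "P \<in> Sylow_subgroups G p" "Q \<in> Sylow_subgroups G p" "P \<noteq> Q" "x \<in> P" "x \<in> Q"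
    using r unfolding redundant_iff by blast
  have "P \<subseteq> Q" if "h ` P \<subseteq> h ` Q" "P \<in> Sylow_subgroups G p" "Q \<in> Sylow_subgroups G p" for P Q
    using that fibre_in_Sylow[OF _ that(3)] K Sylow_subset_p_elements by blast
  then have "h ` P \<noteq> h ` Q" using PQ by blast
  then show "\<exists>P\<in>Sylow_subgroups H p. \<exists>Q\<in>Sylow_subgroups H p. P \<noteq> Q \<and> y \<in> P \<and> y \<in> Q"
    using PQ x by (intro bexI[of _ "h ` P"] bexI[of _ "h ` Q"] image_Sylow) auto
qed

end

section \<open>Groups with a torus containing half of a Sylow 2-subgroup\<close>

context group
begin

lemma index_two_quotient:
  assumes X: "subgroup X G" and P: "subgroup P G" and XP: "X \<subseteq> P" and fin: "finite P"
    and card: "card P = 2 * card X" and w: "w \<in> P" "w \<notin> X" and y: "y \<in> P" "y \<notin> X"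
  shows "inv w \<otimes> y \<in> X"
proof -
  have wc: "w \<in> carrier G" and yc: "y \<in> carrier G" using w y subgroup.mem_carrier[OF P] by auto
  have Xc: "X \<subseteq> carrier G" by (rule subgroup.subset[OF X])
  let ?W = "(\<lambda>u. w \<otimes> u) ` X"
  have "inj_on (\<lambda>u. w \<otimes> u) X" using wc Xc by (intro inj_onI) (auto simp: subset_eq)
  then have cW: "card ?W = card X" by (rule card_image)
  have disj: "X \<inter> ?W = {}"
  proof (rule ccontr)
    assume "X \<inter> ?W \<noteq> {}"
    then obtain u where u: "u \<in> X" "w \<otimes> u \<in> X" by blast
    then have "w \<otimes> u \<otimes> inv u \<in> X" using subgroup.m_closed[OF X] subgroup.m_inv_closed[OF X] by blast
    then show False using u wc Xc w by (simp add: m_assoc subset_eq)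
  qed
  have fX: "finite X" using XP fin finite_subset by blast
  have sub: "X \<union> ?W \<subseteq> P" using XP w subgroup.m_closed[OF P] by blast
  have "card (X \<union> ?W) = card P" using card_Un_disjoint[OF fX _ disj] fX cW card by simp
  then have "X \<union> ?W = P" using sub fin by (simp add: card_subset_eq)
  then obtain u where "u \<in> X" "y = w \<otimes> u" using y by blast
  then show ?thesis using wc Xc by (simp add: inv_mult_cancel_left subset_eq)
qed

lemma index_two_conj:
  assumes X: "subgroup X G" and P: "subgroup P G" and XP: "X \<subseteq> P" and fin: "finite P"
    and card: "card P = 2 * card X" and w: "w \<in> P" "w \<notin> X" and x: "x \<in> X"
  shows "w \<otimes> x \<otimes> inv w \<in> X"
proof (rule ccontr)
  have wc: "w \<in> carrier G" using w subgroup.mem_carrier[OF P] by auto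
  have xc: "x \<in> carrier G" by (rule subgroup.mem_carrier[OF X x])
  assume n: "w \<otimes> x \<otimes> inv w \<notin> X"
  have "w \<otimes> x \<otimes> inv w \<in> P"
    using w x XP subgroup.m_closed[OF P] subgroup.m_inv_closed[OF P] by blast
  then have "inv w \<otimes> (w \<otimes> x \<otimes> inv w) \<in> X"
    using index_two_quotient[OF X P XP fin card w _ n] by simp
  then have "x \<otimes> inv w \<in> X" using wc xc by (simp add: m_assoc inv_mult_cancel_left)
  then have "inv x \<otimes> (x \<otimes> inv w) \<in> X"
    using x subgroup.m_closed[OF X] subgroup.m_inv_closed[OF X] by blast
  then have "inv w \<in> X" using wc xc by (simp add: inv_mult_cancel_left)
  then show False using w wc subgroup.m_inv_closed[OF X] by fastforce
qed

lemma index_two_square: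
  assumes X: "subgroup X G" and P: "subgroup P G" and XP: "X \<subseteq> P" and fin: "finite P"
    and card: "card P = 2 * card X" and w: "w \<in> P" "w \<notin> X"
  shows "w \<otimes> w \<in> X"
proof (rule ccontr)
  have wc: "w \<in> carrier G" using w subgroup.mem_carrier[OF P] by auto
  assume n: "w \<otimes> w \<notin> X"
  then have "inv w \<otimes> (w \<otimes> w) \<in> X"
    using index_two_quotient[OF X P XP fin card w _ n] w subgroup.m_closed[OF P] by simp
  then show False using wc w by (simp add: inv_mult_cancel_left)
qed

lemma conj_commute_iff:
  assumes "w \<in> carrier G" "x \<in> carrier G"
  shows "w \<otimes> x \<otimes> inv w = x \<longleftrightarrow> w \<otimes> x = x \<otimes> w"
  using assms by (metis inv_solve_right m_closed)

end

lemma (in finite_group_prime) two_Sylows_conj: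
  assumes g: "g \<in> carrier G"
    and P: "P \<in> Sylow_subgroups G p" and Q: "Q \<in> Sylow_subgroups G p"
    and PQ: "P \<noteq> Q" "x \<in> P" "x \<in> Q"
  shows "\<exists>P\<in>Sylow_subgroups G p. \<exists>Q\<in>Sylow_subgroups G p.
    P \<noteq> Q \<and> g \<otimes> x \<otimes> inv g \<in> P \<and> g \<otimes> x \<otimes> inv g \<in> Q"
proof -
  have "P \<subseteq> carrier G" "Q \<subseteq> carrier G" using P Q subgroup.subset by (auto simp: Sylow_subgroups_def)
  then have "(\<lambda>x. g \<otimes> x \<otimes> inv g) ` P \<noteq> (\<lambda>x. g \<otimes> x \<otimes> inv g) ` Q"
    using inj_on_image_eq_iff[of "\<lambda>x. g \<otimes> x \<otimes> inv g" "carrier G" P Q] PQ(1)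
      inj_onI[of "carrier G" "\<lambda>x. g \<otimes> x \<otimes> inv g"] conjugation_is_inj[OF g] by simp
  then show ?thesis
    using PQ by (intro bexI[OF _ conj_Sylow[OF P g]] bexI[OF _ conj_Sylow[OF Q g]]) auto
qed

text \<open>Abstracts the situation of a maximal torus \<open>\<langle>t\<rangle>\<close> of order \<open>2 ^ a * m\<close>
  in a group with a single involution \<open>z\<close> whose Sylow 2-subgroups have order \<open>2 ^ (a + 1)\<close>.\<close>
locale torus_group = finite_group_prime G 2 for G (structure) +
  fixes t z and a m :: nat
  assumes t: "t \<in> carrier G" and z: "z \<in> carrier G"
    and ord_t: "ord t = 2 ^ a * m" and odd_m: "odd m" and a2: "2 \<le> a"
    and mult2: "multiplicity 2 (order G) = a + 1"
    and z_ne: "z \<noteq> \<one>" and zz: "z \<otimes> z = \<one>"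
    and square_one: "y \<in> carrier G \<Longrightarrow> y \<otimes> y = \<one> \<Longrightarrow> y = \<one> \<or> y = z"
    and square_z: "y \<in> carrier G \<Longrightarrow> y' \<in> carrier G \<Longrightarrow> y \<otimes> y = z \<Longrightarrow> y' \<otimes> y' = z \<Longrightarrow>
       \<exists>g\<in>carrier G. y' = g \<otimes> y \<otimes> inv g"
    and centralizer: "s \<in> generate G {t} \<Longrightarrow> s \<noteq> \<one> \<Longrightarrow> s \<noteq> z \<Longrightarrow> g \<in> carrier G \<Longrightarrow>
       g \<otimes> s = s \<otimes> g \<Longrightarrow> g \<in> generate G {t}"
    and conj_torus: "s \<in> generate G {t} \<Longrightarrow> s \<noteq> \<one> \<Longrightarrow> s \<noteq> z \<Longrightarrow> g \<in> carrier G \<Longrightarrow>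
       g \<otimes> s \<otimes> inv g \<in> generate G {t} \<Longrightarrow> g \<otimes> s \<otimes> inv g = s \<or> g \<otimes> s \<otimes> inv g = inv s"
begin

abbreviation "T \<equiv> generate G {t}"
definition "x = t [^] m"
abbreviation "X \<equiv> generate G {x}"

lemma x_carrier: "x \<in> carrier G" using t by (simp add: x_def)

lemma ord_x: "ord x = 2 ^ a"
  using ord_pow[OF t, of m] odd_m ord_t by (auto simp: x_def intro: Nat.gr0I)

lemma T_subgroup: "subgroup T G" using t by (simp add: generate_is_subgroup)
lemma X_subgroup: "subgroup X G" using x_carrier by (simp add: generate_is_subgroup)
lemma T_carrier: "s \<in> T \<Longrightarrow> s \<in> carrier G" by (rule subgroup.mem_carrier[OF T_subgroup])

lemma pow_in_T: "t [^] (n::nat) \<in> T"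
  using generate_pow_on_finite_carrier[OF finite_carrier t] by blast

lemma T_commute: assumes "u \<in> T" "v \<in> T" shows "u \<otimes> v = v \<otimes> u"
proof -
  obtain i j :: nat where "u = t [^] i" "v = t [^] j"
    using assms generate_pow_on_finite_carrier[OF finite_carrier t] by blast
  then show ?thesis using t by (simp add: nat_pow_mult add.commute)
qed

lemma x_in_T: "x \<in> T" unfolding x_def by (rule pow_in_T)
lemma X_subset_T: "X \<subseteq> T" using x_in_T T_subgroup by (intro generate_subgroup_incl) auto
lemma x_in_X: "x \<in> X" by (simp add: generate.incl)
lemma card_X: "card X = 2 ^ a" using ord_x x_carrier by (simp flip: generate_pow_card)
lemma card_T: "card T = 2 ^ a * m" using ord_t t by (simp flip: generate_pow_card)

lemma ord_z: "ord z = 2"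
proof -
  have "z [^] (2::nat) = \<one>" using z zz by (simp add: numeral_2_eq_2)
  then have "ord z dvd 2" using z by (simp add: pow_eq_id)
  moreover have "ord z \<noteq> 1" using z z_ne ord_eq_1 by blast
  ultimately show ?thesis by (metis prime_nat_iff two_is_prime_nat)
qed

lemma x_ne: "x \<noteq> \<one>" "x \<noteq> z"
proof -
  have "(2::nat) ^ 2 \<le> 2 ^ a" using a2 by (intro power_increasing) auto
  then have "ord x \<ge> 4" using ord_x by simp
  then show "x \<noteq> \<one>" "x \<noteq> z" using ord_z by auto
qed

lemma Sylow_props:
  assumes P: "P \<in> Sylow_subgroups G 2"
  shows "subgroup P G" "card P = 2 * card X" "finite P" "P \<subseteq> carrier G" "card P = 2 ^ (a + 1)"
proof -
  show s: "subgroup P G" "card P = 2 ^ (a + 1)" using P by (auto simp: Sylow_subgroups_def mult2)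
  then show "card P = 2 * card X" by (simp add: card_X)
  show "P \<subseteq> carrier G" by (rule subgroup.subset[OF s(1)])
  then show "finite P" using finite_carrier finite_subset by blast
qed

lemma X_subset_Sylow:
  assumes "P \<in> Sylow_subgroups G 2" "x \<in> P"
  shows "X \<subseteq> P"
  using assms Sylow_props(1) by (intro generate_subgroup_incl) auto

lemma ex_outside_X:
  assumes P: "P \<in> Sylow_subgroups G 2" "x \<in> P"
  shows "\<exists>w\<in>P. w \<notin> X"
proof (rule ccontr)
  assume "\<not> ?thesis"
  then have "P = X" using X_subset_Sylow[OF P] by blast
  then show False using Sylow_props(2)[OF P(1)] card_X by simp
qed

lemma outside_X_not_in_T:
  assumes P: "P \<in> Sylow_subgroups G 2" "x \<in> P" and w: "w \<in> P" "w \<notin> X"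
  shows "w \<notin> T"
proof
  assume wT: "w \<in> T"
  have "P \<subseteq> T"
  proof
    fix y assume y: "y \<in> P"
    show "y \<in> T"
    proof (cases "y \<in> X")
      case False
      have "inv w \<otimes> y \<in> T"
        using index_two_quotient[OF X_subgroup Sylow_props(1)[OF P(1)] X_subset_Sylow[OF P]
            Sylow_props(3,2)[OF P(1)] w y False] X_subset_T by blast
      then have "w \<otimes> (inv w \<otimes> y) \<in> T" using wT subgroup.m_closed[OF T_subgroup] by blast
      then show ?thesis using w y Sylow_props(4)[OF P(1)] by (simp add: inv_mult_cancel_left subset_eq)
    qed (use X_subset_T in blast)
  qed
  then have "subgroup P (G\<lparr>carrier := T\<rparr>)"
    using Sylow_props(1)[OF P(1)] T_subgroup by (simp add: subgroup_incl)
  then have "card P dvd card T"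
    using group.lagrange[OF subgroup_imp_group[OF T_subgroup]]
    by (metis dvd_triv_right order_def partial_object.select_convs(1) partial_object.update_convs(1) partial_object.surjective)
  then have "2 ^ a * 2 dvd 2 ^ a * m" using Sylow_props(5)[OF P(1)] card_T by (simp add: mult.commute)
  then show False using odd_m by simp
qed

lemma outside_X_inverts_x:
  assumes P: "P \<in> Sylow_subgroups G 2" "x \<in> P" and w: "w \<in> P" "w \<notin> X"
  shows "w \<otimes> x \<otimes> inv w = inv x"
proof -
  have wc: "w \<in> carrier G" using w Sylow_props(4)[OF P(1)] by blast
  have "w \<otimes> x \<otimes> inv w \<in> T"
    using index_two_conj[OF X_subgroup Sylow_props(1)[OF P(1)] X_subset_Sylow[OF P]
            Sylow_props(3,2)[OF P(1)] w x_in_X] X_subset_T by blast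
  moreover have "w \<otimes> x \<otimes> inv w \<noteq> x"
    using centralizer[OF x_in_T x_ne wc] outside_X_not_in_T[OF P w] conj_commute_iff[OF wc x_carrier] by blast
  ultimately show ?thesis using conj_torus[OF x_in_T x_ne wc] by blast
qed

lemma not_redundant:
  assumes m: "m = 1"
  shows "\<not> has_redundant_Sylow G 2"
proof -
  have XT: "X = T" using card_X card_T m X_subset_T finite_carrier subgroup.subset[OF T_subgroup]
    by (metis card_subset_eq finite_subset mult.right_neutral)
  have sub: "Q \<subseteq> P" if P: "P \<in> Sylow_subgroups G 2" "x \<in> P" and Q: "Q \<in> Sylow_subgroups G 2" "x \<in> Q" for P Q
  proof
    fix y assume y: "y \<in> Q"
    show "y \<in> P"
    proof (cases "y \<in> X")
      case True
      then show ?thesis using X_subset_Sylow[OF P] by blast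
    next
      case False
      obtain w where w: "w \<in> P" "w \<notin> X" using ex_outside_X[OF P] by blast
      have c: "w \<in> carrier G" "y \<in> carrier G" using w y Sylow_props(4) P Q by blast+
      note xc = x_carrier
      have "y \<otimes> x \<otimes> inv y = w \<otimes> x \<otimes> inv w"
        using outside_X_inverts_x[OF P w] outside_X_inverts_x[OF Q y False] by simp
      then have "inv w \<otimes> (y \<otimes> x \<otimes> inv y) \<otimes> y = inv w \<otimes> (w \<otimes> x \<otimes> inv w) \<otimes> y" by simp
      then have "(inv w \<otimes> y) \<otimes> x = x \<otimes> (inv w \<otimes> y)"
        using c xc by (simp add: m_assoc inv_mult_cancel_left)
      then have "inv w \<otimes> y \<in> T" using centralizer[OF x_in_T x_ne] c by simp
      then have "w \<otimes> (inv w \<otimes> y) \<in> P"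
        using XT X_subset_Sylow[OF P] w subgroup.m_closed[OF Sylow_props(1)[OF P(1)]] by blast
      then show ?thesis using c by (simp add: inv_mult_cancel_left)
    qed
  qed
  have "x \<in> p_elements G 2" using ord_x x_carrier by (auto simp: p_elements_def)
  then show ?thesis unfolding redundant_iff using sub by blast
qed

lemma x_in_two_Sylows:
  assumes m: "m \<noteq> 1" and P: "P \<in> Sylow_subgroups G 2" "x \<in> P"
  shows "\<exists>Q\<in>Sylow_subgroups G 2. Q \<noteq> P \<and> x \<in> Q"
proof -
  define r where "r = t [^] ((2::nat) ^ a)"
  have rT: "r \<in> T" unfolding r_def by (rule pow_in_T)
  have rc: "r \<in> carrier G" using rT T_carrier by blast
  have ord_r: "ord r = m"
    using ord_pow[OF t, of "2 ^ a"] ord_t by (simp add: r_def)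
  have r1: "r \<noteq> \<one>" using ord_r m by auto
  have rz: "r \<noteq> z" using ord_r ord_z odd_m by auto
  let ?Q = "(\<lambda>x. r \<otimes> x \<otimes> inv r) ` P"
  have Q: "?Q \<in> Sylow_subgroups G 2" by (rule conj_Sylow[OF P(1) rc])
  have "x = r \<otimes> x \<otimes> inv r"
    using conj_commute_iff[OF rc x_carrier] T_commute[OF rT x_in_T] by simp
  then have xQ: "x \<in> ?Q" using P(2) by (rule image_eqI)
  have "?Q \<noteq> P"
  proof
    assume eq: "?Q = P"
    obtain w where w: "w \<in> P" "w \<notin> X" using ex_outside_X[OF P] by blast
    have wc: "w \<in> carrier G" using w Sylow_props(4)[OF P(1)] by blast
    have wT: "w \<notin> T" by (rule outside_X_not_in_T[OF P w])
    note xc = x_carrier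
    have inv: "w \<otimes> x \<otimes> inv w = inv x" by (rule outside_X_inverts_x[OF P w])
    have "w \<otimes> r \<otimes> inv w \<otimes> inv x = w \<otimes> (r \<otimes> x) \<otimes> inv w"
      unfolding inv[symmetric] using wc rc xc by (simp add: m_assoc inv_mult_cancel_left)
    also have "\<dots> = w \<otimes> (x \<otimes> r) \<otimes> inv w" using T_commute[OF rT x_in_T] by simp
    also have "\<dots> = inv x \<otimes> (w \<otimes> r \<otimes> inv w)"
      unfolding inv[symmetric] using wc rc xc by (simp add: m_assoc inv_mult_cancel_left)
    finally have comm: "w \<otimes> r \<otimes> inv w \<otimes> inv x = inv x \<otimes> (w \<otimes> r \<otimes> inv w)" .
    have "inv x \<in> T" using x_in_T subgroup.m_inv_closed[OF T_subgroup] by blast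
    moreover have "inv x \<noteq> \<one>" "inv x \<noteq> z"
      using x_ne xc inv_equality[OF zz z z] inv_inv[OF xc] by auto
    ultimately have "w \<otimes> r \<otimes> inv w \<in> T"
      using centralizer[OF _ _ _ _ comm] wc rc by simp
    moreover have "w \<otimes> r \<otimes> inv w \<noteq> r"
      using centralizer[OF rT r1 rz wc] wT conj_commute_iff[OF wc rc] by blast
    ultimately have wr: "w \<otimes> r \<otimes> inv w = inv r" using conj_torus[OF rT r1 rz wc] by blast
    have "r \<otimes> w \<otimes> inv r \<in> P" using eq w(1) by blast
    then have "inv w \<otimes> (r \<otimes> w \<otimes> inv r) \<in> P"
      using w(1) subgroup.m_closed[OF Sylow_props(1)[OF P(1)]] subgroup.m_inv_closed[OF Sylow_props(1)[OF P(1)]]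
      by blast
    moreover have "r \<otimes> w = w \<otimes> inv r"
    proof -
      have "r \<otimes> w \<otimes> r = r \<otimes> (w \<otimes> r \<otimes> inv w) \<otimes> w" using wc rc by (simp add: m_assoc)
      then have "r \<otimes> w \<otimes> r = w" using wr wc rc by simp
      then show ?thesis using wc rc by (metis inv_solve_right m_closed)
    qed
    ultimately have "inv r \<otimes> inv r \<in> P" using wc rc by (simp add: m_assoc inv_mult_cancel_left)
    then have "inv (inv r \<otimes> inv r) \<in> P" using subgroup.m_inv_closed[OF Sylow_props(1)[OF P(1)]] by blast
    then have rr: "r \<otimes> r \<in> P" using rc by (simp add: inv_mult_group)
    then obtain n where n: "ord (r \<otimes> r) = 2 ^ n"
      using Sylow_subset_p_elements[OF P(1)] by (auto simp: p_elements_def)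
    have "(r \<otimes> r) [^] m = \<one>"
      using rc ord_r pow_ord_eq_1[OF rc] by (simp add: pow_mult_distrib)
    then have "2 ^ n dvd m" using n rc by (simp add: pow_eq_id)
    then have "n = 0" using odd_m by (metis dvd_power dvd_trans gr0I)
    then have "r \<otimes> r = \<one>" using n ord_eq_1[of "r \<otimes> r"] rc by simp
    then show False using square_one[OF rc] r1 rz by blast
  qed
  then show ?thesis using xQ by (intro bexI[OF _ Q]) simp
qed

lemma redundant:
  assumes m: "m \<noteq> 1"
  shows "has_redundant_Sylow G 2"
proof (rule redundant_if_no_unique)
  fix y assume y: "y \<in> p_elements G 2"
  have "x \<in> p_elements G 2" using ord_x x_carrier by (auto simp: p_elements_def)
  then obtain P where P: "P \<in> Sylow_subgroups G 2" "x \<in> P" using p_element_in_Sylow by blast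
  obtain Q where Q: "Q \<in> Sylow_subgroups G 2" "Q \<noteq> P" "x \<in> Q" using x_in_two_Sylows[OF m P] by blast
  have XPQ: "X \<subseteq> P" "X \<subseteq> Q" using X_subset_Sylow P Q by blast+
  have two: "\<exists>P\<in>Sylow_subgroups G 2. \<exists>Q\<in>Sylow_subgroups G 2.
    P \<noteq> Q \<and> g \<otimes> s \<otimes> inv g \<in> P \<and> g \<otimes> s \<otimes> inv g \<in> Q" if "s \<in> X" "g \<in> carrier G" for g s
    using two_Sylows_conj[OF that(2) P(1) Q(1)] Q XPQ that by blast
  obtain R where R: "R \<in> Sylow_subgroups G 2" "y \<in> R" using p_element_in_Sylow[OF y] by blast
  obtain g where g: "g \<in> carrier G" "R = (\<lambda>x. g \<otimes> x \<otimes> inv g) ` P" using Sylow_conj[OF P(1) R(1)] by blast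
  then obtain w where w: "w \<in> P" "y = g \<otimes> w \<otimes> inv g" using R by blast
  have wc: "w \<in> carrier G" using w Sylow_props(4)[OF P(1)] by blast
  show "\<exists>P\<in>Sylow_subgroups G 2. \<exists>Q\<in>Sylow_subgroups G 2. P \<noteq> Q \<and> y \<in> P \<and> y \<in> Q"
  proof (cases "w \<in> X")
    case True
    then show ?thesis using two[OF _ g(1)] w by simp
  next
    case False
    define v where "v = x [^] ((2::nat) ^ (a - 2))"
    have vX: "v \<in> X" using generate_pow_on_finite_carrier[OF finite_carrier x_carrier] by (auto simp: v_def)
    have vc: "v \<in> carrier G" using x_carrier by (simp add: v_def)
    have "ord v = 2 ^ a div 2 ^ (a - 2)"
      unfolding v_def using a2 by (subst ord_pow[OF x_carrier]) (auto simp: ord_x le_imp_power_dvd)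
    also have "\<dots> = 4" using a2 power_diff[of 2 "a - (a - 2)" a] by (simp flip: power_diff)
    finally have ord_v: "ord v = 4" .
    have pv: "(v \<otimes> v) \<otimes> (v \<otimes> v) = v [^] (4::nat)" "v \<otimes> v = v [^] (2::nat)"
      using vc by (simp_all add: numeral_eq_Suc m_assoc)
    then have "(v \<otimes> v) \<otimes> (v \<otimes> v) = \<one>" "v \<otimes> v \<noteq> \<one>" using vc ord_v by (simp_all add: pow_eq_id)
    then have vz: "v \<otimes> v = z" using square_one[of "v \<otimes> v"] vc by blast
    then have zX: "z \<in> X" using vX subgroup.m_closed[OF X_subgroup] by blast
    have wT: "w \<notin> T" by (rule outside_X_not_in_T[OF P w(1) False])
    have "w \<otimes> w \<in> X"
      by (rule index_two_square[OF X_subgroup Sylow_props(1)[OF P(1)] X_subset_Sylow[OF P]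
            Sylow_props(3,2)[OF P(1)] w(1) False])
    then have "w \<otimes> w = \<one> \<or> w \<otimes> w = z"
      using centralizer[of "w \<otimes> w" w] wT X_subset_T wc by (auto simp: m_assoc)
    moreover have "w \<otimes> w \<noteq> \<one>"
      using square_one[OF wc] False zX subgroup.one_closed[OF X_subgroup] by blast
    ultimately obtain k where k: "k \<in> carrier G" "w = k \<otimes> v \<otimes> inv k"
      using square_z[OF vc wc vz] by blast
    have "y = (g \<otimes> k) \<otimes> v \<otimes> inv (g \<otimes> k)"
      using w(2) k g(1) vc by (simp add: m_assoc inv_mult_group)
    then show ?thesis using two[OF vX, of "g \<otimes> k"] g(1) k(1) by simp
  qed
qed

end

section \<open>The group SL(2,F)\<close>

lemma mem_SL2 [simp]: "(a, b, c, d) \<in> carrier SL2 \<longleftrightarrow> a * d - b * c = 1"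
  by (simp add: SL2_def)

lemma mult_SL2 [simp]:
  "(a, b, c, d) \<otimes>\<^bsub>SL2\<^esub> (a', b', c', d') =
     (a * a' + b * c', a * b' + b * d', c * a' + d * c', c * b' + d * d')"
  by (simp add: SL2_def mat2_mult_def)

lemma one_SL2: "\<one>\<^bsub>SL2\<^esub> = (1, 0, 0, 1)"
  by (simp add: SL2_def)

lemma group_SL2: "group (SL2 :: ('a::field \<times> 'a \<times> 'a \<times> 'a) monoid)"
proof (rule groupI)
  fix x y z :: "'a \<times> 'a \<times> 'a \<times> 'a"
  assume x: "x \<in> carrier SL2"
  obtain a b c d where xe: "x = (a, b, c, d)" by (cases x)
  then have det: "a * d - b * c = 1" using x by simp
  obtain a' b' c' d' where ye: "y = (a', b', c', d')" by (cases y)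
  obtain a'' b'' c'' d'' where ze: "z = (a'', b'', c'', d'')" by (cases z)
  show "x \<otimes>\<^bsub>SL2\<^esub> y \<otimes>\<^bsub>SL2\<^esub> z = x \<otimes>\<^bsub>SL2\<^esub> (y \<otimes>\<^bsub>SL2\<^esub> z)"
    unfolding xe ye ze by (simp add: algebra_simps)
  show "\<one>\<^bsub>SL2\<^esub> \<otimes>\<^bsub>SL2\<^esub> x = x" by (simp add: xe one_SL2)
  show "\<exists>y\<in>carrier SL2. y \<otimes>\<^bsub>SL2\<^esub> x = \<one>\<^bsub>SL2\<^esub>"
    by (rule bexI[of _ "(d, -b, -c, a)"]) (use det in \<open>auto simp: xe one_SL2 algebra_simps\<close>)
  assume y: "y \<in> carrier SL2"
  then have "a' * d' - b' * c' = 1" using ye by simp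
  then have "(a * d - b * c) * (a' * d' - b' * c') = 1" using det by simp
  then show "x \<otimes>\<^bsub>SL2\<^esub> y \<in> carrier SL2"
    by (simp add: xe ye algebra_simps)
qed (simp add: one_SL2)

interpretation SL2: group "SL2 :: ('a::field \<times> 'a \<times> 'a \<times> 'a) monoid"
  by (rule group_SL2)

lemma inv_SL2:
  assumes "a * d - b * c = 1"
  shows "inv\<^bsub>SL2\<^esub> (a, b, c, d) = (d, -b, -c, a)"
  using assms by (intro SL2.inv_equality) (auto simp: one_SL2 algebra_simps)

lemma finite_SL2: "finite (carrier (SL2 :: ('a::{field,finite} \<times> 'a \<times> 'a \<times> 'a) monoid))"
  by (rule finite_subset[OF subset_UNIV]) simp

lemma card_field_ge_2: "card (UNIV :: 'a::{field,finite} set) \<ge> 2"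
proof -
  have "card {0, 1 :: 'a} \<le> card (UNIV :: 'a set)" by (rule card_mono) auto
  then show ?thesis by simp
qed

lemma order_SL2:
  fixes q defines "q \<equiv> card (UNIV :: 'a::{field,finite} set)"
  shows "order (SL2 :: ('a \<times> 'a \<times> 'a \<times> 'a) monoid) = q * ((q - 1) * (q + 1))"
proof -
  let ?A = "(\<lambda>(a, b, c). (a, b, c, (1 + b * c) / a)) ` ((UNIV - {0 :: 'a}) \<times> UNIV \<times> UNIV)"
  let ?B = "(\<lambda>(b, d). (0 :: 'a, b, - 1 / b, d)) ` ((UNIV - {0 :: 'a}) \<times> (UNIV :: 'a set))"
  have 1: "carrier SL2 = ?A \<union> ?B"
  proof (intro equalityI subsetI)
    fix x :: "'a \<times> 'a \<times> 'a \<times> 'a" assume x: "x \<in> carrier SL2"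
    obtain a b c d where xe: "x = (a, b, c, d)" by (cases x)
    then have det: "a * d - b * c = 1" using x by simp
    show "x \<in> ?A \<union> ?B"
    proof (cases "a = 0")
      case True
      then have "b * c = -1" using det by (metis add.inverse_inverse diff_0 mult_zero_left)
      then have b: "b \<noteq> 0" by auto
      then have "c = - 1 / b" using \<open>b * c = -1\<close> by (metis nonzero_mult_div_cancel_left)
      then have "x \<in> ?B" using True b by (intro image_eqI[of _ _ "(b, d)"]) (auto simp: xe)
      then show ?thesis by blast
    next
      case False
      then have "x \<in> ?A" using det by (intro image_eqI[of _ _ "(a, b, c)"]) (auto simp: xe field_simps)
      then show ?thesis by blast
    qed
  qed (auto split: if_splits)
  have c0: "card (UNIV - {0 :: 'a}) = q - 1" by (simp add: q_def)
  have "inj_on (\<lambda>(a, b, c). (a, b, c, (1 + b * c) / a)) ((UNIV - {0 :: 'a}) \<times> UNIV \<times> UNIV)"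
    by (auto simp: inj_on_def)
  moreover have "card (UNIV :: ('a \<times> 'a) set) = q * q"
    by (simp add: q_def card_cartesian_product flip: UNIV_Times_UNIV)
  ultimately have A: "card ?A = (q - 1) * (q * q)"
    by (subst card_image) (auto simp: card_cartesian_product c0)
  have "inj_on (\<lambda>(b, d). (0 :: 'a, b, - 1 / b, d)) ((UNIV - {0 :: 'a}) \<times> (UNIV :: 'a set))"
    by (auto simp: inj_on_def)
  then have B: "card ?B = (q - 1) * q"
    by (subst card_image) (auto simp: card_cartesian_product c0 q_def[symmetric])
  have "card (?A \<union> ?B) = card ?A + card ?B"
    by (intro card_Un_disjoint) auto
  then show ?thesis unfolding order_def 1 A B by (simp add: algebra_simps)
qed

definition trace2 :: "'a::field \<times> 'a \<times> 'a \<times> 'a \<Rightarrow> 'a" where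
  "trace2 M = (case M of (a, b, c, d) \<Rightarrow> a + d)"

lemma trace2_conj:
  assumes "g \<in> carrier SL2" "s \<in> carrier SL2"
  shows "trace2 (g \<otimes>\<^bsub>SL2\<^esub> s \<otimes>\<^bsub>SL2\<^esub> inv\<^bsub>SL2\<^esub> g) = trace2 s"
proof -
  have comm: "trace2 (x \<otimes>\<^bsub>SL2\<^esub> y) = trace2 (y \<otimes>\<^bsub>SL2\<^esub> x)" for x y :: "'a \<times> 'a \<times> 'a \<times> 'a"
    by (cases x, cases y) (simp add: trace2_def algebra_simps)
  have "trace2 (g \<otimes>\<^bsub>SL2\<^esub> s \<otimes>\<^bsub>SL2\<^esub> inv\<^bsub>SL2\<^esub> g) = trace2 (inv\<^bsub>SL2\<^esub> g \<otimes>\<^bsub>SL2\<^esub> (g \<otimes>\<^bsub>SL2\<^esub> s))"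
    by (rule comm)
  then show ?thesis using assms by (simp add: SL2.inv_mult_cancel_left)
qed

lemma square_one_SL2:
  assumes two: "(2 :: 'a::field) \<noteq> 0" and y: "y \<in> carrier (SL2 :: ('a \<times> 'a \<times> 'a \<times> 'a) monoid)"
    and yy: "y \<otimes>\<^bsub>SL2\<^esub> y = \<one>\<^bsub>SL2\<^esub>"
  shows "y = \<one>\<^bsub>SL2\<^esub> \<or> y = (-1, 0, 0, -1)"
proof -
  obtain a b c d where ye: "y = (a, b, c, d)" by (cases y)
  have det: "a * d - b * c = 1" using y ye by simp
  have "(d, - b, - c, a) = (a, b, c, d)"
    using SL2.inv_equality[OF yy y y] unfolding ye inv_SL2[OF det] .
  then have e: "a = d" "- b = b" "- c = c" unfolding prod.inject by iprover+
  have "2 * b = 0" "2 * c = 0" using e(2,3) by (metis add.right_inverse mult_2)+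
  then have bc: "b = 0" "c = 0" using two by auto
  then have "a * a = 1" using det e by simp
  then have "(a - 1) * (a + 1) = 0" by (simp add: algebra_simps)
  then have "a = 1 \<or> a = -1" by (auto simp: eq_neg_iff_add_eq_0)
  then show ?thesis using bc e by (auto simp: ye one_SL2)
qed

lemma sum_two_squares:
  fixes c :: "'a::{field,finite}"
  shows "\<exists>x y. x * x + y * y = c"
proof -
  define S where "S = range (\<lambda>x :: 'a. x * x)"
  define f where "f s = (SOME x :: 'a. x * x = s)" for s
  have f: "f (x * x) * f (x * x) = x * x" for x
    unfolding f_def by (rule someI[of _ x]) simp
  have "x \<in> f ` S \<union> uminus ` f ` S" for x
  proof -
    have "(x - f (x * x)) * (x + f (x * x)) = 0" using f[of x] by (simp add: algebra_simps)
    then have "x = f (x * x) \<or> x = - f (x * x)" by (auto simp: eq_neg_iff_add_eq_0)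
    then show ?thesis by (auto simp: S_def)
  qed
  then have un: "f ` S \<union> uminus ` f ` S = UNIV" by blast
  have "f 0 = 0" using f[of 0] by simp
  moreover have "0 \<in> S" unfolding S_def by (rule image_eqI[of _ _ 0]) auto
  ultimately have z: "0 \<in> f ` S \<inter> uminus ` f ` S" by (metis IntI image_eqI neg_0_equal_iff_equal)
  have "card (f ` S \<inter> uminus ` f ` S) > 0" using z by (metis card_gt_0_iff empty_iff finite)
  then have "card (f ` S) + card (uminus ` f ` S) > card (UNIV :: 'a set)"
    using card_Un_Int[of "f ` S" "uminus ` f ` S"] un by simp
  moreover have "card (f ` S) \<le> card S" "card (uminus ` f ` S) \<le> card S"
    by (meson card_image_le finite le_trans)+
  ultimately have big: "card S + card S > card (UNIV :: 'a set)" by linarith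
  have inj: "card ((\<lambda>s. c - s) ` S) = card S" by (rule card_image) (auto simp: inj_on_def)
  have "S \<inter> (\<lambda>s. c - s) ` S \<noteq> {}"
  proof
    assume "S \<inter> (\<lambda>s. c - s) ` S = {}"
    then have "card (S \<union> (\<lambda>s. c - s) ` S) = card S + card S"
      using inj by (simp add: card_Un_disjoint)
    moreover have "card (S \<union> (\<lambda>s. c - s) ` S) \<le> card (UNIV :: 'a set)" by (rule card_mono) auto
    ultimately show False using big by linarith
  qed
  then obtain s where "s \<in> S" "c - s \<in> S" by (metis (no_types, lifting) IntE add_diff_cancel_left' diff_add_cancel ex_in_conv imageE)
  then obtain x y where "s = x * x" "c - s = y * y" by (auto simp: S_def)
  then have "x * x + y * y = c" by (metis add.commute diff_add_cancel)
  then show ?thesis by blast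
qed

text \<open>The change of basis matrix has columns \<open>v\<close> and \<open>y v\<close>, where \<open>v\<close> is chosen so that
  its determinant, a binary quadratic form in \<open>v\<close>, takes the value 1.\<close>
lemma square_minus_one_conj:
  fixes y :: "'a::{field,finite} \<times> 'a \<times> 'a \<times> 'a"
  assumes two: "(2 :: 'a) \<noteq> 0" and y: "y \<in> carrier SL2" and yy: "y \<otimes>\<^bsub>SL2\<^esub> y = (-1, 0, 0, -1)"
  shows "\<exists>g\<in>carrier SL2. y = g \<otimes>\<^bsub>SL2\<^esub> (0, -1, 1, 0) \<otimes>\<^bsub>SL2\<^esub> inv\<^bsub>SL2\<^esub> g"
proof -
  obtain a b c d where ye: "y = (a, b, c, d)" by (cases y)
  have det: "a * d - b * c = 1" using y ye by simp
  have e: "a * a + b * c = -1" "a * b + b * d = 0" "c * a + d * c = 0" "c * b + d * d = -1"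
    using yy by (auto simp: ye)
  have "a + d = (a * d - b * c) * (a + d)" using det by simp
  also have "\<dots> = d * (a * a + b * c) + a * (c * b + d * d) - (a * b + b * d) * c - b * (c * a + d * c)"
    by (simp add: algebra_simps)
  also have "\<dots> = - (a + d)" using e by simp
  finally have "2 * (a + d) = 0" by (metis add.right_inverse mult_2)
  then have d: "d = - a" using two by (metis add.commute eq_neg_iff_add_eq_0 mult_eq_0_iff)
  have "\<exists>v w. c * (v * v) - 2 * a * v * w - b * (w * w) = 1"
  proof (cases "c = 0")
    case True
    then have "a \<noteq> 0" using e(1) by auto
    then have "c * (((-1 - b) / (2 * a)) * ((-1 - b) / (2 * a))) - 2 * a * ((-1 - b) / (2 * a)) * 1 - b * (1 * 1) = 1"
      using True two by (simp add: field_simps)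
    then show ?thesis by blast
  next
    case False
    obtain r w where rw: "r * r + w * w = c" using sum_two_squares by blast
    define v where "v = (r + a * w) / c"
    have cv: "c * v = r + a * w" using False by (simp add: v_def)
    have "c * (c * (v * v) - 2 * a * v * w - b * (w * w)) = (c * v) * (c * v) - 2 * a * w * (c * v) - b * c * (w * w)"
      by (simp add: algebra_simps)
    also have "\<dots> = r * r - (a * a + b * c) * (w * w)" unfolding cv by (simp add: algebra_simps)
    also have "\<dots> = c" using e(1) rw by simp
    finally have "c * (v * v) - 2 * a * v * w - b * (w * w) = 1" using False by simp
    then show ?thesis by blast
  qed
  then obtain v w where vw: "c * (v * v) - 2 * a * v * w - b * (w * w) = 1" by blast
  define g where "g = (v, a * v + b * w, w, c * v - a * w)"
  have g: "g \<in> carrier SL2" using vw by (simp add: g_def algebra_simps)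
  have "y \<otimes>\<^bsub>SL2\<^esub> g = g \<otimes>\<^bsub>SL2\<^esub> (0, -1, 1, 0)"
  proof -
    have "a * (a * v + b * w) + b * (c * v - a * w) = (a * a + b * c) * v" by (simp add: algebra_simps)
    moreover have "c * (a * v + b * w) - a * (c * v - a * w) = (a * a + b * c) * w" by (simp add: algebra_simps)
    ultimately show ?thesis using e(1) by (simp add: ye g_def d)
  qed
  then have "y = g \<otimes>\<^bsub>SL2\<^esub> (0, -1, 1, 0) \<otimes>\<^bsub>SL2\<^esub> inv\<^bsub>SL2\<^esub> g"
    using y g by (metis SL2.inv_closed SL2.inv_solve_right SL2.m_closed)
  then show ?thesis using g by blast
qed

lemma square_minus_one_conj2:
  fixes y y' :: "'a::{field,finite} \<times> 'a \<times> 'a \<times> 'a"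
  assumes two: "(2 :: 'a) \<noteq> 0" and y: "y \<in> carrier SL2" "y' \<in> carrier SL2"
    and yy: "y \<otimes>\<^bsub>SL2\<^esub> y = (-1, 0, 0, -1)" "y' \<otimes>\<^bsub>SL2\<^esub> y' = (-1, 0, 0, -1)"
  shows "\<exists>g\<in>carrier SL2. y' = g \<otimes>\<^bsub>SL2\<^esub> y \<otimes>\<^bsub>SL2\<^esub> inv\<^bsub>SL2\<^esub> g"
proof -
  let ?J = "(0, -1, 1, 0) :: 'a \<times> 'a \<times> 'a \<times> 'a"
  have J: "?J \<in> carrier SL2" by simp
  obtain g where g: "g \<in> carrier SL2" "y = g \<otimes>\<^bsub>SL2\<^esub> ?J \<otimes>\<^bsub>SL2\<^esub> inv\<^bsub>SL2\<^esub> g"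
    using square_minus_one_conj[OF two y(1) yy(1)] by blast
  obtain h where h: "h \<in> carrier SL2" "y' = h \<otimes>\<^bsub>SL2\<^esub> ?J \<otimes>\<^bsub>SL2\<^esub> inv\<^bsub>SL2\<^esub> h"
    using square_minus_one_conj[OF two y(2) yy(2)] by blast
  have "?J = inv\<^bsub>SL2\<^esub> g \<otimes>\<^bsub>SL2\<^esub> y \<otimes>\<^bsub>SL2\<^esub> g"
    using SL2.inv_conj_conj[OF g(1) J] g(2) by simp
  then have "y' = (h \<otimes>\<^bsub>SL2\<^esub> inv\<^bsub>SL2\<^esub> g) \<otimes>\<^bsub>SL2\<^esub> y \<otimes>\<^bsub>SL2\<^esub> inv\<^bsub>SL2\<^esub> (h \<otimes>\<^bsub>SL2\<^esub> inv\<^bsub>SL2\<^esub> g)"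
    using h g(1) y by (simp add: SL2.m_assoc SL2.inv_mult_group)
  then show ?thesis using g(1) h(1) by blast
qed

section \<open>Tori\<close>

definition field_rec :: "'a::field ring" where
  "field_rec = \<lparr>carrier = UNIV, mult = (*), one = 1, zero = 0, add = (+)\<rparr>"

lemma field_field_rec: "field (field_rec :: 'a::field ring)"
proof -
  have "cring (field_rec :: 'a ring)"
  proof (intro cringI abelian_groupI comm_monoidI)
    fix x :: 'a
    show "\<exists>y\<in>carrier field_rec. y \<oplus>\<^bsub>field_rec\<^esub> x = \<zero>\<^bsub>field_rec\<^esub>"
      by (rule bexI[of _ "- x"]) (auto simp: field_rec_def)
  qed (auto simp: field_rec_def algebra_simps)
  then show ?thesis
  proof (rule cring.cring_fieldI2)
    fix x :: 'a
    assume "x \<in> carrier field_rec" "x \<noteq> \<zero>\<^bsub>field_rec\<^esub>"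
    then show "\<exists>y\<in>carrier field_rec. x \<otimes>\<^bsub>field_rec\<^esub> y = \<one>\<^bsub>field_rec\<^esub>"
      by (intro bexI[of _ "inverse x"]) (auto simp: field_rec_def)
  qed (simp add: field_rec_def)
qed

lemma nat_pow_field_rec: "x [^]\<^bsub>field_rec\<^esub> (n::nat) = (x ^ n :: 'a::field)"
  by (induction n) (auto simp: field_rec_def nat_pow_def)

lemma finite_field_generator:
  "\<exists>g :: 'a::{field,finite}. g \<noteq> 0 \<and> (\<forall>x. x \<noteq> 0 \<longrightarrow> (\<exists>i::nat. x = g ^ i))"
proof -
  have "finite (carrier (field_rec :: 'a ring))" by (rule finite_subset[OF subset_UNIV]) simp
  from field.finite_field_mult_group_has_gen[OF field_field_rec this]
  obtain g where "g \<in> carrier (mult_of (field_rec :: 'a ring))"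
    "carrier (mult_of (field_rec :: 'a ring)) = {g [^]\<^bsub>field_rec\<^esub> (i::nat) | i. i \<in> UNIV}"
    by auto
  then have "g \<noteq> 0" "UNIV - {0} = {g ^ i | i. i \<in> (UNIV :: nat set)}"
    unfolding nat_pow_field_rec by (auto simp: field_rec_def)
  then show ?thesis by blast
qed

lemma finite_field_fermat:
  fixes x :: "'a::{field,finite}"
  assumes "x \<noteq> 0"
  shows "x ^ (card (UNIV :: 'a set) - 1) = 1"
proof -
  interpret field "field_rec :: 'a ring" by (rule field_field_rec)
  have "x \<in> carrier (mult_of field_rec)" using assms by (simp add: field_rec_def)
  from group.pow_order_eq_1[OF field_mult_group this]
  have "x [^]\<^bsub>field_rec\<^esub> order (mult_of (field_rec :: 'a ring)) = \<one>\<^bsub>field_rec\<^esub>" by (simp add: nat_pow_mult_of)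
  moreover have "order (mult_of (field_rec :: 'a ring)) = card (UNIV :: 'a set) - 1"
    by (simp add: order_def field_rec_def)
  ultimately show ?thesis by (simp add: nat_pow_field_rec) (simp add: field_rec_def)
qed

lemma SL2_generate: "t \<in> carrier (SL2 :: ('a::{field,finite} \<times> 'a \<times> 'a \<times> 'a) monoid) \<Longrightarrow>
   generate SL2 {t} = {t [^]\<^bsub>SL2\<^esub> (k::nat) | k. k \<in> UNIV}"
  by (rule SL2.generate_pow_on_finite_carrier[OF finite_SL2])

definition is_torus_gen :: "'a::{field,finite} \<times> 'a \<times> 'a \<times> 'a \<Rightarrow> bool" where
  "is_torus_gen t \<longleftrightarrow> t \<in> carrier SL2 \<and>
     (\<forall>s\<in>generate SL2 {t}. s \<noteq> \<one>\<^bsub>SL2\<^esub> \<longrightarrow> s \<noteq> (-1, 0, 0, -1) \<longrightarrow> (\<forall>g\<in>carrier SL2.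
        (g \<otimes>\<^bsub>SL2\<^esub> s = s \<otimes>\<^bsub>SL2\<^esub> g \<longrightarrow> g \<in> generate SL2 {t}) \<and>
        (g \<otimes>\<^bsub>SL2\<^esub> s \<otimes>\<^bsub>SL2\<^esub> inv\<^bsub>SL2\<^esub> g \<in> generate SL2 {t} \<longrightarrow>
           g \<otimes>\<^bsub>SL2\<^esub> s \<otimes>\<^bsub>SL2\<^esub> inv\<^bsub>SL2\<^esub> g = s \<or> g \<otimes>\<^bsub>SL2\<^esub> s \<otimes>\<^bsub>SL2\<^esub> inv\<^bsub>SL2\<^esub> g = inv\<^bsub>SL2\<^esub> s)))"

lemma split_torus:
  "\<exists>t :: 'a::{field,finite} \<times> 'a \<times> 'a \<times> 'a. is_torus_gen t \<and> group.ord SL2 t = card (UNIV :: 'a set) - 1"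
proof -
  obtain g :: 'a where g: "g \<noteq> 0" "\<And>x. x \<noteq> 0 \<Longrightarrow> \<exists>i::nat. x = g ^ i"
    using finite_field_generator by blast
  define t where "t = (g, 0 :: 'a, 0 :: 'a, 1 / g)"
  have tc: "t \<in> carrier SL2" using g by (simp add: t_def)
  have pow: "t [^]\<^bsub>SL2\<^esub> n = (g ^ n, 0, 0, 1 / g ^ n)" for n :: nat
  proof (induction n)
    case 0 show ?case by (simp add: one_SL2)
  next
    case (Suc n) then show ?case by (simp add: t_def mult.commute)
  qed
  have gen: "generate SL2 {t} = (\<lambda>l. (l, 0 :: 'a, 0 :: 'a, 1 / l)) ` (UNIV - {0})"
  proof (intro equalityI subsetI)
    fix y assume "y \<in> generate SL2 {t}"
    then obtain k :: nat where "y = t [^]\<^bsub>SL2\<^esub> k" using SL2_generate[OF tc] by blast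
    then show "y \<in> (\<lambda>l. (l, 0 :: 'a, 0 :: 'a, 1 / l)) ` (UNIV - {0})" using pow g(1) by auto
  next
    fix y assume "y \<in> (\<lambda>l::'a. (l, 0::'a, 0::'a, 1 / l)) ` (UNIV - {0})"
    then obtain l where l: "l \<noteq> 0" "y = (l, 0, 0, 1 / l)" by blast
    then obtain k :: nat where "l = g ^ k" using g(2) by blast
    then have "y = t [^]\<^bsub>SL2\<^esub> k" using l pow by simp
    then show "y \<in> generate SL2 {t}" using SL2_generate[OF tc] by blast
  qed
  have "card (generate SL2 {t}) = card (UNIV - {0::'a})"
    unfolding gen by (rule card_image) (auto simp: inj_on_def)
  then have "group.ord SL2 t = card (UNIV :: 'a set) - 1"
    using SL2.generate_pow_card[OF tc] by simp
  moreover have "is_torus_gen t"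
    unfolding is_torus_gen_def
  proof (intro conjI ballI impI)
    fix s h :: "'a \<times> 'a \<times> 'a \<times> 'a"
    assume s: "s \<in> generate SL2 {t}" "s \<noteq> \<one>\<^bsub>SL2\<^esub>" "s \<noteq> (-1, 0, 0, -1)" and h: "h \<in> carrier SL2"
    obtain l where l: "l \<noteq> 0" "s = (l, 0, 0, 1 / l)" using s(1) gen by blast
    have sc: "s \<in> carrier SL2" using l by simp
    have l2: "l * l \<noteq> 1"
    proof
      assume "l * l = 1"
      then have "(l - 1) * (l + 1) = 0" by (simp add: algebra_simps)
      then have "l = 1 \<or> l = -1" by (auto simp: eq_neg_iff_add_eq_0)
      then show False using s l by (auto simp: one_SL2)
    qed
    obtain a b c d where he: "h = (a, b, c, d)" by (cases h)
    have det: "a * d - b * c = 1" using h he by simp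
    {
      assume "h \<otimes>\<^bsub>SL2\<^esub> s = s \<otimes>\<^bsub>SL2\<^esub> h"
      then have "b / l = l * b" "c * l = c / l" by (auto simp: he l)
      then have "b * (l * l - 1) = 0" "c * (l * l - 1) = 0" using l(1) by (auto simp: field_simps)
      then have bc: "b = 0" "c = 0" using l2 by auto
      then have ad: "a * d = 1" using det by simp
      then have "a \<noteq> 0" "d = 1 / a" using inverse_unique[OF ad] by (auto simp: divide_inverse)
      then show "h \<in> generate SL2 {t}" unfolding gen he using bc by auto
    }
    {
      assume "h \<otimes>\<^bsub>SL2\<^esub> s \<otimes>\<^bsub>SL2\<^esub> inv\<^bsub>SL2\<^esub> h \<in> generate SL2 {t}"
      then obtain k where k: "k \<noteq> 0" "h \<otimes>\<^bsub>SL2\<^esub> s \<otimes>\<^bsub>SL2\<^esub> inv\<^bsub>SL2\<^esub> h = (k, 0, 0, 1 / k)" using gen by auto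
      then have "k + 1 / k = l + 1 / l" using trace2_conj[OF h sc] l by (simp add: trace2_def)
      then have "(k - l) * (k * l - 1) = 0" using k(1) l(1) by (simp add: field_simps)
      then have "k = l \<or> k * l = 1" by auto
      then have "k = l \<or> k = 1 / l" using l(1) by (auto simp: eq_divide_eq)
      moreover have "inv\<^bsub>SL2\<^esub> s = (1 / l, 0, 0, l)" using l by (simp add: inv_SL2)
      ultimately show "h \<otimes>\<^bsub>SL2\<^esub> s \<otimes>\<^bsub>SL2\<^esub> inv\<^bsub>SL2\<^esub> h = s \<or> h \<otimes>\<^bsub>SL2\<^esub> s \<otimes>\<^bsub>SL2\<^esub> inv\<^bsub>SL2\<^esub> h = inv\<^bsub>SL2\<^esub> s"
        using k l by auto
    }
  qed (rule tc)
  ultimately show ?thesis by blast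
qed

text \<open>The pair \<open>(a, b)\<close> stands for \<open>a + b \<theta>\<close> with \<open>\<theta>\<^sup>2 + \<theta> = c\<close>, a quadratic extension in every
  characteristic when \<open>x\<^sup>2 + x = c\<close> has no root; \<open>quad_mat\<close> is multiplication by \<open>a + b \<theta>\<close> in the basis
  \<open>1, \<theta>\<close>.\<close>
definition quad_ext :: "'a::field \<Rightarrow> ('a \<times> 'a) ring" where
  "quad_ext c = \<lparr>carrier = UNIV,
     mult = (\<lambda>(a, b) (a', b'). (a * a' + c * b * b', a * b' + b * a' - b * b')),
     one = (1, 0), zero = (0, 0), add = (\<lambda>(a, b) (a', b'). (a + a', b + b'))\<rparr>"

definition quad_norm :: "'a::field \<Rightarrow> 'a \<times> 'a \<Rightarrow> 'a" where
  "quad_norm c u = (case u of (a, b) \<Rightarrow> a * a - a * b - c * b * b)"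

definition quad_mat :: "'a::field \<Rightarrow> 'a \<times> 'a \<Rightarrow> 'a \<times> 'a \<times> 'a \<times> 'a" where
  "quad_mat c u = (case u of (a, b) \<Rightarrow> (a, b * c, b, a - b))"

lemma irreducible_quadratic_exists: "\<exists>c :: 'a::{field,finite}. \<forall>x. x * x + x \<noteq> c"
proof -
  have "\<not> inj (\<lambda>x :: 'a. x * x + x)"
  proof
    assume "inj (\<lambda>x :: 'a. x * x + x)"
    then have "(-1 :: 'a) = 0" by (rule injD) simp
    then show False by simp
  qed
  then have "\<not> surj (\<lambda>x :: 'a. x * x + x)" using finite_UNIV_surj_inj[OF finite] by blast
  then show ?thesis unfolding surj_def by metis
qed

lemma quad_norm_eq_0:
  assumes c: "\<And>x. x * x + x \<noteq> c" and "quad_norm c (a, b) = 0"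
  shows "a = 0 \<and> b = 0"
proof (cases "b = 0")
  case False
  have "(- (a / b)) * (- (a / b)) + (- (a / b)) = c"
    using assms(2) False by (simp add: quad_norm_def field_simps)
  then show ?thesis using c by blast
qed (use assms(2) in \<open>auto simp: quad_norm_def\<close>)

lemma quad_norm_mult:
  "quad_norm c (u \<otimes>\<^bsub>quad_ext c\<^esub> v) = quad_norm c u * quad_norm c v"
  by (cases u, cases v) (simp add: quad_norm_def quad_ext_def algebra_simps)

lemma field_quad_ext:
  assumes c: "\<And>x. x * x + x \<noteq> c"
  shows "field (quad_ext c)"
proof -
  have "cring (quad_ext c)"
  proof (intro cringI abelian_groupI comm_monoidI)
    fix x :: "'a \<times> 'a"
    show "\<exists>y\<in>carrier (quad_ext c). y \<oplus>\<^bsub>quad_ext c\<^esub> x = \<zero>\<^bsub>quad_ext c\<^esub>"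
      by (rule bexI[of _ "(- fst x, - snd x)"]) (cases x, auto simp: quad_ext_def)
  qed (auto simp: quad_ext_def algebra_simps)
  then show ?thesis
  proof (rule cring.cring_fieldI2)
    fix x :: "'a \<times> 'a"
    assume x: "x \<noteq> \<zero>\<^bsub>quad_ext c\<^esub>"
    obtain a b where xe: "x = (a, b)" by (cases x)
    define n where "n = quad_norm c x"
    have n: "n \<noteq> 0" using x quad_norm_eq_0[OF c, of a b] by (auto simp: n_def xe quad_ext_def)
    have ne: "a * (a - b) - c * b * b = n" by (simp add: n_def xe quad_norm_def algebra_simps)
    have "a * ((a - b) / n) + c * b * (- b / n) = (a * (a - b) - c * b * b) / n"
      using n by (simp add: field_simps)
    also have "\<dots> = 1" using ne n by simp
    finally have "a * ((a - b) / n) + c * b * (- b / n) = 1" .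
    moreover have "a * (- b / n) + b * ((a - b) / n) - b * (- b / n) = 0"
      using n by (simp add: field_simps)
    ultimately have "x \<otimes>\<^bsub>quad_ext c\<^esub> ((a - b) / n, - b / n) = \<one>\<^bsub>quad_ext c\<^esub>"
      by (simp add: quad_ext_def xe)
    then show "\<exists>y\<in>carrier (quad_ext c). x \<otimes>\<^bsub>quad_ext c\<^esub> y = \<one>\<^bsub>quad_ext c\<^esub>"
      by (intro bexI[of _ "((a - b) / n, - b / n)"]) (auto simp: quad_ext_def)
  qed (simp add: quad_ext_def)
qed

lemma quad_mat_mult: "quad_mat c u \<otimes>\<^bsub>SL2\<^esub> quad_mat c v = quad_mat c (u \<otimes>\<^bsub>quad_ext c\<^esub> v)"
  by (cases u, cases v) (simp add: quad_mat_def quad_ext_def algebra_simps)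

lemma quad_mat_in_SL2: "quad_mat c u \<in> carrier SL2 \<longleftrightarrow> quad_norm c u = 1"
  by (cases u) (simp add: quad_mat_def quad_norm_def algebra_simps)

lemma inj_quad_mat: "inj (quad_mat c)"
  by (auto simp: inj_def quad_mat_def)

text \<open>The conic \<open>quad_norm c u = 1\<close> is parametrized by the slopes of the lines through \<open>(1, 0)\<close>.\<close>
lemma card_quad_norm_one:
  fixes c :: "'a::{field,finite}"
  assumes c: "\<And>x. x * x + x \<noteq> c"
  shows "card {u. quad_norm c u = 1} \<le> card (UNIV :: 'a set) + 1"
proof -
  let ?f = "\<lambda>u :: 'a \<times> 'a. if snd u = 0 then (if fst u = 1 then None else Some (1 / 2))
    else Some ((fst u - 1) / snd u)"
  have key: "b * (s * s - s - c) = 1 - 2 * s"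
    if "quad_norm c (1 + s * b, b) = 1" "b \<noteq> 0" for s b
  proof -
    have "b * (b * (s * s - s - c) - (1 - 2 * s)) = quad_norm c (1 + s * b, b) - 1"
      by (simp add: quad_norm_def algebra_simps)
    then show ?thesis using that by simp
  qed
  have ns: "s * s - s - c \<noteq> 0" for s
  proof
    assume "s * s - s - c = 0"
    then have "(- s) * (- s) + (- s) = c" by simp
    then show False using c by blast
  qed
  have on_axis: "a = 1 \<or> a = -1" if "quad_norm c (a, 0) = 1" for a
  proof -
    have "(a - 1) * (a + 1) = 0" using that by (simp add: quad_norm_def algebra_simps)
    then show ?thesis by (auto simp: eq_neg_iff_add_eq_0)
  qed
  have slope: "(a - 1) / b \<noteq> 1 / 2"
    if "quad_norm c (a, b) = 1" "b \<noteq> 0" "(-1 :: 'a) \<noteq> 1" for a b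
  proof
    assume s: "(a - 1) / b = 1 / 2"
    have two: "(2 :: 'a) \<noteq> 0" using that(3) by (metis add.inverse_unique one_add_one)
    define s :: 'a where "s = 1 / 2"
    have "a - 1 = s * b" using s that(2) unfolding s_def by (metis nonzero_eq_divide_eq)
    then have "a = 1 + s * b" by (simp add: algebra_simps)
    then have "b * (s * s - s - c) = 1 - 2 * s" using key that by simp
    also have "\<dots> = 0" using two by (simp add: s_def)
    finally show False using that(2) ns by simp
  qed
  have off_axis: "u = v" if "quad_norm c u = 1" "quad_norm c v = 1" "snd u \<noteq> 0" "snd v \<noteq> 0"
    "(fst u - 1) / snd u = (fst v - 1) / snd v" for u v
  proof -
    obtain a b where u: "u = (a, b)" by (cases u)
    obtain a' b' where v: "v = (a', b')" by (cases v)
    define s where "s = (a - 1) / b"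
    have b: "b \<noteq> 0" "b' \<noteq> 0" using that u v by auto
    have a: "a = 1 + s * b" using b by (simp add: s_def)
    have a': "a' = 1 + s * b'" using b that(5) by (simp add: s_def u v)
    have "b * (s * s - s - c) = b' * (s * s - s - c)"
      using key[of s b] key[of s b'] b that(1,2) by (simp add: u v a a')
    then have "b = b'" using ns by simp
    then show "u = v" using a a' u v by simp
  qed
  have "inj_on ?f {u. quad_norm c u = 1}"
  proof (rule inj_onI)
    fix u v assume uv: "u \<in> {u. quad_norm c u = 1}" "v \<in> {u. quad_norm c u = 1}" "?f u = ?f v"
    obtain a b where u: "u = (a, b)" by (cases u)
    obtain a' b' where v: "v = (a', b')" by (cases v)
    have n: "quad_norm c (a, b) = 1" "quad_norm c (a', b') = 1" using uv u v by auto
    consider "b = 0" "b' = 0" | "b = 0" "b' \<noteq> 0" | "b \<noteq> 0" "b' = 0" | "b \<noteq> 0" "b' \<noteq> 0" by blast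
    then show "u = v"
    proof cases
      case 1
      then show ?thesis using on_axis n uv(3) u v by (auto split: if_splits)
    next
      case 2
      then have "a \<noteq> 1" "(a' - 1) / b' = 1 / 2" using uv(3) u v by (auto split: if_splits)
      then show ?thesis using 2 on_axis slope n by metis
    next
      case 3
      then have "a' \<noteq> 1" "(a - 1) / b = 1 / 2" using uv(3) u v by (auto split: if_splits)
      then show ?thesis using 3 on_axis slope n by metis
    next
      case 4
      then show ?thesis using off_axis[of u v] n uv(3) u v by simp
    qed
  qed
  then have "card {u. quad_norm c u = 1} \<le> card (insert None (range (Some :: 'a \<Rightarrow> _)))"
    by (rule card_inj_on_le) auto
  also have "\<dots> = card (UNIV :: 'a set) + 1"
    by (subst card_insert_disjoint) (auto simp: card_image)
  finally show ?thesis .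
qed

lemma quad_four_c:
  fixes c :: "'a::field"
  assumes c: "\<And>x. x * x + x \<noteq> c"
  shows "1 + 4 * c \<noteq> 0"
proof
  assume h: "1 + 4 * c = 0"
  have four: "(4 :: 'a) = 2 * 2" by simp
  have two: "(2 :: 'a) \<noteq> 0"
  proof
    assume "(2 :: 'a) = 0"
    then have "(4 :: 'a) = 0" unfolding four by (metis mult_zero_left)
    then show False using h by simp
  qed
  define r :: 'a where "r = 1 / 2"
  have r: "2 * r = 1" using two by (simp add: r_def)
  have "4 * ((- r) * (- r) + (- r)) = (2 * r) * (2 * r) - 2 * (2 * r)" by (simp add: algebra_simps)
  also have "\<dots> = -1" unfolding r by simp
  also have "\<dots> = 4 * c" using h by (metis add.commute eq_neg_iff_add_eq_0)
  finally have "4 * ((- r) * (- r) + (- r)) = 4 * c" .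
  moreover have "(4 :: 'a) \<noteq> 0" using h by auto
  ultimately show False using c by (metis mult_left_cancel)
qed

lemma quad_norm_trace_eq:
  fixes c :: "'a::field"
  assumes c: "\<And>x. x * x + x \<noteq> c"
    and n: "quad_norm c (a, b) = 1" "quad_norm c (a', b') = 1" and tr: "2 * a - b = 2 * a' - b'"
  shows "(a', b') = (a, b) \<or> (a', b') = (a - b, - b)"
proof -
  define e where "e = a - a'"
  have a': "a' = a - e" by (simp add: e_def)
  have b': "b' = b - 2 * e" using tr by (simp add: e_def algebra_simps)
  have "e * ((e - b) * (1 + 4 * c)) = quad_norm c (a, b) - quad_norm c (a', b')"
    unfolding a' b' quad_norm_def by (simp add: algebra_simps)
  then have "e * (e - b) = 0" using n quad_four_c[OF c] by simp
  then have "e = 0 \<or> e = b" by auto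
  then show ?thesis using a' b' by auto
qed

lemma nonsplit_torus:
  "\<exists>t :: 'a::{field,finite} \<times> 'a \<times> 'a \<times> 'a. is_torus_gen t \<and> group.ord SL2 t = card (UNIV :: 'a set) + 1"
proof -
  define q where "q = card (UNIV :: 'a set)"
  have q2: "q \<ge> 2" unfolding q_def by (rule card_field_ge_2)
  obtain c :: 'a where c: "\<And>x. x * x + x \<noteq> c" using irreducible_quadratic_exists by blast
  let ?K = "quad_ext c"
  interpret K: field ?K by (rule field_quad_ext[OF c])
  have finK: "finite (carrier ?K)" by (rule finite_subset[OF subset_UNIV]) simp
  interpret M: group "mult_of ?K" by (rule K.field_mult_group)
  have cM: "carrier (mult_of ?K) = UNIV - {(0, 0)}" by (simp add: quad_ext_def)
  obtain g where g: "g \<in> carrier (mult_of ?K)"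
    "carrier (mult_of ?K) = {g [^]\<^bsub>?K\<^esub> (i::nat) | i. i \<in> UNIV}"
    using K.finite_field_mult_group_has_gen[OF finK] by auto
  have finM: "finite (carrier (mult_of ?K))" unfolding cM by simp
  have "generate (mult_of ?K) {g} = carrier (mult_of ?K)"
    using M.generate_pow_on_finite_carrier[OF finM g(1)] g(2) by (simp add: nat_pow_mult_of)
  then have "group.ord (mult_of ?K) g = card (UNIV - {(0 :: 'a, 0 :: 'a)})"
    using M.generate_pow_card[OF g(1)] cM by metis
  also have "\<dots> = q * q - 1"
  proof -
    have "card (UNIV :: ('a \<times> 'a) set) = q * q"
      by (simp add: q_def card_cartesian_product flip: UNIV_Times_UNIV)
    then show ?thesis by simp
  qed
  also have "\<dots> = (q - 1) * (q + 1)" using q2 by (simp add: algebra_simps)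
  finally have ord_g: "group.ord (mult_of ?K) g = (q - 1) * (q + 1)" .
  define u where "u = g [^]\<^bsub>?K\<^esub> (q - 1)"
  have uM: "u \<in> carrier (mult_of ?K)"
    using M.nat_pow_closed[OF g(1), of "q - 1"] by (simp add: u_def nat_pow_mult_of)
  have nz: "q - 1 \<noteq> 0" using q2 by simp
  have "q - 1 dvd group.ord (mult_of ?K) g" unfolding ord_g by (rule dvd_triv_left)
  from M.ord_pow[OF g(1) this nz] have ord_u: "group.ord (mult_of ?K) u = q + 1"
    unfolding ord_g nonzero_mult_div_cancel_left[OF nz] u_def nat_pow_mult_of .
  have norm_pow: "quad_norm c (v [^]\<^bsub>?K\<^esub> n) = quad_norm c v ^ n" for v and n :: nat
  proof (induction n)
    case 0 show ?case by (simp add: quad_norm_def) (simp add: quad_ext_def)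
  next
    case (Suc n) then show ?case by (simp add: quad_norm_mult mult.commute)
  qed
  have "quad_norm c g \<noteq> 0"
    using g(1) quad_norm_eq_0[OF c, of "fst g" "snd g"] unfolding cM by (metis DiffE insertI1 prod.collapse)
  then have nu: "quad_norm c u = 1"
    unfolding u_def norm_pow q_def by (rule finite_field_fermat)
  define t where "t = quad_mat c u"
  have tc: "t \<in> carrier SL2" unfolding t_def quad_mat_in_SL2 by (rule nu)
  have pow: "t [^]\<^bsub>SL2\<^esub> n = quad_mat c (u [^]\<^bsub>?K\<^esub> n)" for n :: nat
  proof (induction n)
    case 0 show ?case by (simp add: one_SL2 quad_mat_def) (simp add: quad_ext_def)
  next
    case (Suc n) then show ?case by (simp add: t_def quad_mat_mult)
  qed
  have one: "\<one>\<^bsub>SL2\<^esub> = quad_mat c \<one>\<^bsub>?K\<^esub>" by (simp add: one_SL2 quad_mat_def quad_ext_def)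
  have "t [^]\<^bsub>SL2\<^esub> n = \<one>\<^bsub>SL2\<^esub> \<longleftrightarrow> q + 1 dvd n" for n :: nat
    unfolding pow one inj_eq[OF inj_quad_mat] using M.pow_eq_id[OF uM, of n] ord_u
    by (simp add: nat_pow_mult_of)
  then have ord_t: "group.ord SL2 t = q + 1" using SL2.ord_unique[OF tc] by blast
  have gen: "generate SL2 {t} = quad_mat c ` {v. quad_norm c v = 1}"
  proof (rule card_seteq)
    show "finite (quad_mat c ` {v. quad_norm c v = 1})" by simp
    show "generate SL2 {t} \<subseteq> quad_mat c ` {v. quad_norm c v = 1}"
      unfolding SL2_generate[OF tc] pow by (intro subsetI) (auto simp del: split_paired_All simp: nu norm_pow)
    have "card (quad_mat c ` {v. quad_norm c v = 1}) \<le> q + 1"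
      using card_quad_norm_one[OF c] card_image_le[of "{v. quad_norm c v = 1}" "quad_mat c"]
      unfolding q_def by (meson finite le_trans)
    then show "card (quad_mat c ` {v. quad_norm c v = 1}) \<le> card (generate SL2 {t})"
      using SL2.generate_pow_card[OF tc] ord_t by simp
  qed
  have "is_torus_gen t"
    unfolding is_torus_gen_def
  proof (intro conjI ballI impI)
    fix s h :: "'a \<times> 'a \<times> 'a \<times> 'a"
    assume s: "s \<in> generate SL2 {t}" "s \<noteq> \<one>\<^bsub>SL2\<^esub>" "s \<noteq> (-1, 0, 0, -1)" and h: "h \<in> carrier SL2"
    obtain a b where ab: "quad_norm c (a, b) = 1" "s = quad_mat c (a, b)" using s(1) gen by auto
    have sc: "s \<in> carrier SL2" unfolding ab(2) quad_mat_in_SL2 by (rule ab(1))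
    have b0: "b \<noteq> 0"
    proof
      assume b: "b = 0"
      then have "(a - 1) * (a + 1) = 0" using ab(1) by (simp add: quad_norm_def algebra_simps)
      then have "a = 1 \<or> a = -1" by (auto simp: eq_neg_iff_add_eq_0)
      then show False using s ab b by (auto simp: one_SL2 quad_mat_def)
    qed
    obtain x y w z where he: "h = (x, y, w, z)" by (cases h)
    {
      assume "h \<otimes>\<^bsub>SL2\<^esub> s = s \<otimes>\<^bsub>SL2\<^esub> h"
      then have e: "x * a + y * b = a * x + b * c * w" "w * a + z * b = b * x + (a - b) * w"
        by (simp_all add: he ab(2) quad_mat_def)
      have "b * (y - w * c) = 0" "b * (z - (x - w)) = 0"
        using e by (simp_all add: algebra_simps)
      then have "y = w * c" "z = x - w" using b0 by auto
      then have hq: "h = quad_mat c (x, w)" by (simp add: he quad_mat_def)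
      then have "quad_norm c (x, w) = 1" using h quad_mat_in_SL2 by blast
      then show "h \<in> generate SL2 {t}" unfolding gen hq by blast
    }
    {
      assume "h \<otimes>\<^bsub>SL2\<^esub> s \<otimes>\<^bsub>SL2\<^esub> inv\<^bsub>SL2\<^esub> h \<in> generate SL2 {t}"
      then obtain a' b' where ab': "quad_norm c (a', b') = 1"
        "h \<otimes>\<^bsub>SL2\<^esub> s \<otimes>\<^bsub>SL2\<^esub> inv\<^bsub>SL2\<^esub> h = quad_mat c (a', b')" using gen by auto
      have "trace2 (quad_mat c (a', b')) = trace2 (quad_mat c (a, b))"
        using trace2_conj[OF h sc] ab(2) ab'(2) by simp
      then have "2 * a - b = 2 * a' - b'" by (simp add: trace2_def quad_mat_def)
      from quad_norm_trace_eq[OF c ab(1) ab'(1) this]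
      have "quad_mat c (a', b') = s \<or> quad_mat c (a', b') = quad_mat c (a - b, - b)" using ab(2) by auto
      moreover have "inv\<^bsub>SL2\<^esub> s = quad_mat c (a - b, - b)"
      proof -
        have "a * (a - b) - b * c * b = 1" using ab(1) by (simp add: quad_norm_def algebra_simps)
        then show ?thesis by (simp add: ab(2) quad_mat_def inv_SL2)
      qed
      ultimately show "h \<otimes>\<^bsub>SL2\<^esub> s \<otimes>\<^bsub>SL2\<^esub> inv\<^bsub>SL2\<^esub> h = s \<or> h \<otimes>\<^bsub>SL2\<^esub> s \<otimes>\<^bsub>SL2\<^esub> inv\<^bsub>SL2\<^esub> h = inv\<^bsub>SL2\<^esub> s"
        using ab' by simp
    }
  qed (rule tc)
  then show ?thesis using ord_t unfolding q_def by blast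
qed

section \<open>Sylow subgroups of SL(2,q) and PSL(2,q)\<close>

lemma multiplicity_order_SL2:
  fixes q p :: nat defines "q \<equiv> card (UNIV :: 'a::{field,finite} set)"
  assumes p: "prime p" and nd: "\<not> p dvd q"
  shows "multiplicity p (order (SL2 :: ('a \<times> 'a \<times> 'a \<times> 'a) monoid)) =
    multiplicity p (q - 1) + multiplicity p (q + 1)"
proof -
  have nz: "q \<noteq> 0" "q - 1 \<noteq> 0" "q + 1 \<noteq> 0" using card_field_ge_2[where 'a = 'a] by (auto simp: q_def)
  then have nz2: "(q - 1) * (q + 1) \<noteq> 0" by (simp del: mult_Suc_right)
  have pe: "prime_elem p" using p by simp
  show ?thesis
    unfolding order_SL2 q_def[symmetric]
      prime_elem_multiplicity_mult_distrib[OF pe nz(1) nz2] prime_elem_multiplicity_mult_distrib[OF pe nz(2,3)]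
    using nd by (simp add: not_dvd_imp_multiplicity_0)
qed

lemma not_redundant_SL2_odd:
  fixes p :: nat
  assumes p: "prime p" "odd p" and nd: "\<not> p dvd card (UNIV :: 'a::{field,finite} set)"
  shows "\<not> has_redundant_Sylow (SL2 :: ('a \<times> 'a \<times> 'a \<times> 'a) monoid) p"
proof -
  define q where "q = card (UNIV :: 'a set)"
  have q2: "q \<ge> 2" unfolding q_def by (rule card_field_ge_2)
  let ?G = "SL2 :: ('a \<times> 'a \<times> 'a \<times> 'a) monoid"
  interpret finite_group_prime ?G p by unfold_locales (auto simp: finite_SL2 p)
  have m: "multiplicity p (order ?G) = multiplicity p (q - 1) + multiplicity p (q + 1)"
    unfolding q_def by (rule multiplicity_order_SL2[OF p(1) nd])
  have "\<not> (p dvd q - 1 \<and> p dvd q + 1)"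
  proof
    assume h: "p dvd q - 1 \<and> p dvd q + 1"
    then have "p dvd (q + 1) - (q - 1)" using dvd_diff_nat by blast
    then have "p dvd 2" using q2 by simp
    then have "p = 2" using p by (simp add: primes_dvd_imp_eq)
    then show False using p by simp
  qed
  then consider "multiplicity p (order ?G) = multiplicity p (q + 1)" | "multiplicity p (order ?G) = multiplicity p (q - 1)"
    using m by (cases "p dvd q + 1") (auto simp: not_dvd_imp_multiplicity_0)
  then obtain N t where t: "N \<noteq> 0" "t \<in> carrier ?G" "SL2.ord t = N"
    "multiplicity p (order ?G) = multiplicity p N"
  proof cases
    case 1
    obtain t :: "'a \<times> 'a \<times> 'a \<times> 'a" where "is_torus_gen t" "SL2.ord t = q + 1"
      using nonsplit_torus unfolding q_def by blast
    then show ?thesis using 1 that[of "q + 1" t] by (simp add: is_torus_gen_def)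
  next
    case 2
    obtain t :: "'a \<times> 'a \<times> 'a \<times> 'a" where "is_torus_gen t" "SL2.ord t = q - 1"
      using split_torus unfolding q_def by blast
    then show ?thesis using 2 that[of "q - 1" t] q2 by (simp add: is_torus_gen_def)
  qed
  obtain k where k: "N = p ^ multiplicity p N * k" using multiplicity_dvd by blast
  then have "k \<noteq> 0" using t(1) by (metis mult_0_right)
  have "SL2.ord (t [^]\<^bsub>?G\<^esub> k) = SL2.ord t div k"
    by (rule SL2.ord_pow[OF t(2)]) (use t(3) k \<open>k \<noteq> 0\<close> in \<open>auto intro: dvdI[of _ _ "p ^ multiplicity p N"] simp: mult.commute\<close>)
  also have "\<dots> = p ^ multiplicity p (order ?G)"
    using t k \<open>k \<noteq> 0\<close> by (metis nonzero_mult_div_cancel_right)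
  finally show ?thesis using t(2) by (intro not_redundant_if_cyclic_Sylow[of "t [^]\<^bsub>?G\<^esub> k"]) auto
qed

definition additive_group :: "'a::field monoid" where
  "additive_group = \<lparr>carrier = UNIV, mult = (+), one = 0\<rparr>"

lemma additive_group_simps [simp]:
  "carrier additive_group = UNIV" "x \<otimes>\<^bsub>additive_group\<^esub> y = x + y" "\<one>\<^bsub>additive_group\<^esub> = 0"
  by (simp_all add: additive_group_def)

lemma group_additive: "group (additive_group :: 'a::field monoid)"
proof (rule groupI)
  fix x :: 'a
  show "\<exists>y\<in>carrier additive_group. y \<otimes>\<^bsub>additive_group\<^esub> x = \<one>\<^bsub>additive_group\<^esub>"
    by (rule bexI[of _ "- x"]) auto
qed (auto simp: algebra_simps)

lemma nat_pow_additive: "y [^]\<^bsub>additive_group\<^esub> n = of_nat n * (y :: 'a::field)" for n :: nat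
  by (induction n) (auto simp: nat_pow_def algebra_simps)

lemma of_nat_prime_dvd_card_eq_0:
  fixes p :: nat
  assumes p: "prime p" "p dvd card (UNIV :: 'a::{field,finite} set)"
  shows "of_nat p = (0 :: 'a)"
proof -
  let ?A = "additive_group :: 'a monoid"
  interpret A: group ?A by (rule group_additive)
  obtain m where m: "card (UNIV :: 'a set) = p ^ 1 * m" using p by auto
  have "order ?A = p ^ 1 * m" using m by (simp add: order_def)
  from sylow_thm[OF p(1) A.is_group this] obtain H where H: "subgroup H ?A" "card H = p" by auto
  have "H \<noteq> {0}" using H p by auto
  moreover have "0 \<in> H" using subgroup.one_closed[OF H(1)] by simp
  ultimately obtain x where x: "x \<in> H" "x \<noteq> 0" by blast
  interpret H: group "?A\<lparr>carrier := H\<rparr>" by (rule A.subgroup_imp_group[OF H(1)])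
  have "x [^]\<^bsub>?A\<^esub> card H = 0"
    using H.pow_order_eq_1[of x] x by (simp add: order_def flip: A.nat_pow_consistent)
  then have "of_nat p * x = 0" using nat_pow_additive H by metis
  then show ?thesis using x by simp
qed

lemma card_field_prime_power:
  fixes p :: nat
  assumes p: "prime p" "p dvd card (UNIV :: 'a::{field,finite} set)"
  shows "\<exists>k. card (UNIV :: 'a set) = p ^ k"
proof -
  define q where "q = card (UNIV :: 'a set)"
  have q2: "q \<ge> 2" unfolding q_def by (rule card_field_ge_2)
  obtain n where n: "q = p ^ multiplicity p q * n" "\<not> p dvd n"
    using multiplicity_decompose'[of q p] p q2 by (metis not_numeral_le_zero not_prime_unit)
  have "n = 1"
  proof (rule ccontr)
    assume "n \<noteq> 1"
    then obtain r where r: "prime r" "r dvd n" using prime_factor_nat by blast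
    then have "r dvd q" using n(1) by (metis dvd_mult)
    then have r0: "of_nat r = (0 :: 'a)" using of_nat_prime_dvd_card_eq_0 r(1) unfolding q_def by blast
    have p0: "of_nat p = (0 :: 'a)" by (rule of_nat_prime_dvd_card_eq_0[OF p])
    have "r \<noteq> p" using r n by auto
    then have "coprime (int r) (int p)" using r(1) p(1) primes_coprime by (simp add: primes_coprime)
    then obtain u v where "u * int r + v * int p = 1" using bezout_int by (metis coprime_iff_gcd_eq_1)
    then have "of_int (u * int r + v * int p) = (1 :: 'a)" by simp
    then show False using r0 p0 by simp
  qed
  then show ?thesis using n(1) unfolding q_def by (metis mult.right_neutral)
qed

lemma not_redundant_SL2_char:
  fixes p :: nat
  assumes p: "prime p" "p dvd card (UNIV :: 'a::{field,finite} set)"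
  shows "\<not> has_redundant_Sylow (SL2 :: ('a \<times> 'a \<times> 'a \<times> 'a) monoid) p"
proof -
  let ?G = "SL2 :: ('a \<times> 'a \<times> 'a \<times> 'a) monoid"
  define q where "q = card (UNIV :: 'a set)"
  have q2: "q \<ge> 2" unfolding q_def by (rule card_field_ge_2)
  interpret finite_group_prime ?G p by unfold_locales (auto simp: finite_SL2 p)
  obtain k where k: "q = p ^ k" using card_field_prime_power[OF p] by (auto simp: q_def)
  have dq: "p dvd q" using p by (simp add: q_def)
  have "\<not> p dvd (q - 1) * (q + 1)"
  proof
    assume "p dvd (q - 1) * (q + 1)"
    then have "p dvd q - 1 \<or> p dvd q + 1" using p(1) prime_dvd_mult_iff by blast
    then have "p dvd 1"
    proof
      assume "p dvd q - 1"
      then have "p dvd q - (q - 1)" using dq dvd_diff_nat by blast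
      then show ?thesis using q2 by simp
    next
      assume "p dvd q + 1"
      then show ?thesis using dq by (simp only: dvd_add_right_iff)
    qed
    then show False using p(1) by simp
  qed
  then have mult: "multiplicity p (order ?G) = k"
    unfolding order_SL2 q_def[symmetric] using p(1)
    by (intro multiplicity_eqI) (auto simp: k prime_gt_0_nat mult_ac)
  define U where "U = range (\<lambda>b :: 'a. (1 :: 'a, b, 0 :: 'a, 1 :: 'a))"
  have U: "U \<in> Sylow_subgroups ?G p"
  proof -
    have "subgroup U ?G"
      by (rule SL2.subgroupI) (auto simp: U_def inv_SL2)
    moreover have "card U = q" unfolding U_def q_def by (rule card_image) (auto simp: inj_on_def)
    ultimately show ?thesis using k by (simp add: Sylow_subgroups_def mult)
  qed
  show ?thesis
  proof (rule not_redundant_if_unique[OF _ U])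
    show "(1, 1, 0, 1) \<in> p_elements ?G p"
      using Sylow_subset_p_elements[OF U] by (auto simp: U_def)
    fix Q assume Q: "Q \<in> Sylow_subgroups ?G p" "(1, 1, 0, 1) \<in> Q"
    obtain g where g: "g \<in> carrier ?G" "Q = (\<lambda>x. g \<otimes>\<^bsub>?G\<^esub> x \<otimes>\<^bsub>?G\<^esub> inv\<^bsub>?G\<^esub> g) ` U"
      using Sylow_conj[OF U Q(1)] by blast
    obtain a b c d where ge: "g = (a, b, c, d)" by (cases g)
    have det: "a * d - b * c = 1" using g(1) ge by simp
    have conj: "g \<otimes>\<^bsub>?G\<^esub> (1, t, 0, 1) \<otimes>\<^bsub>?G\<^esub> inv\<^bsub>?G\<^esub> g = (1 - t * a * c, t * a * a, - t * c * c, 1 + t * a * c)" for t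
    proof -
      have "a * d - (a * t + b) * c = (a * d - b * c) - t * a * c" by (simp add: algebra_simps)
      moreover have "(c * t + d) * a - c * b = (a * d - b * c) + t * a * c" by (simp add: algebra_simps)
      ultimately show ?thesis using det by (simp add: ge inv_SL2 algebra_simps)
    qed
    obtain t where "(1, 1, 0, 1) = (1 - t * a * c, t * a * a, - t * c * c, 1 + t * a * c)"
      using Q(2) unfolding g(2) U_def image_image conj by blast
    then have "t * a * a = 1" "t * c * c = 0" by simp_all
    then have "c = 0" by auto
    then have "Q \<subseteq> U" unfolding g(2) U_def image_image conj by auto
    moreover have "card Q = card U" using Q U by (simp add: Sylow_subgroups_def)
    moreover have "finite U" unfolding U_def by simp
    ultimately show "Q = U" by (simp add: card_subset_eq)
  qed
qed

lemma two_neq_zero_if_odd_card: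
  assumes odd: "odd (card (UNIV :: 'a::{field,finite} set))"
  shows "(2 :: 'a) \<noteq> 0"
proof
  assume z: "(2 :: 'a) = 0"
  let ?A = "additive_group :: 'a monoid"
  interpret A: group ?A by (rule group_additive)
  have one: "(1 :: 'a) + 1 = 0" using z by simp
  then have "inv\<^bsub>?A\<^esub> 1 = 1" by (intro A.inv_equality) auto
  moreover have "inv\<^bsub>?A\<^esub> 0 = 0" by (intro A.inv_equality) auto
  ultimately have "subgroup {0, 1 :: 'a} ?A" using one by (intro A.subgroupI) auto
  from A.lagrange[OF this] have "card (rcosets\<^bsub>?A\<^esub> {0, 1}) * 2 = card (UNIV :: 'a set)"
    by (simp add: order_def)
  then have "2 dvd card (UNIV :: 'a set)" by (metis dvd_triv_right)
  then show False using odd by simp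
qed

lemma torus_group_SL2:
  fixes t :: "'a::{field,finite} \<times> 'a \<times> 'a \<times> 'a"
  assumes two: "(2 :: 'a) \<noteq> 0" and t: "is_torus_gen t" and ord: "group.ord SL2 t = 2 ^ a * m"
    and m: "odd m" and a: "2 \<le> a"
    and mult: "multiplicity 2 (order (SL2 :: ('a \<times> 'a \<times> 'a \<times> 'a) monoid)) = a + 1"
  shows "torus_group SL2 t (-1, 0, 0, -1) a m"
proof -
  let ?G = "SL2 :: ('a \<times> 'a \<times> 'a \<times> 'a) monoid"
  interpret finite_group_prime ?G 2 by unfold_locales (auto simp: finite_SL2)
  have tc: "t \<in> carrier ?G" using t unfolding is_torus_gen_def by blast
  have ne: "(-1, 0, 0, -1) \<noteq> \<one>\<^bsub>?G\<^esub>"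
  proof
    assume "(-1, 0, 0, -1) = \<one>\<^bsub>?G\<^esub>"
    then have "(-1 :: 'a) = 1" by (simp add: one_SL2)
    then show False using two by (metis add.right_inverse one_add_one)
  qed
  have z: "(-1, 0, 0, -1) \<in> carrier ?G" "(-1, 0, 0, -1) \<otimes>\<^bsub>?G\<^esub> (-1, 0, 0, -1) = \<one>\<^bsub>?G\<^esub>"
    by (simp_all add: one_SL2)
  show ?thesis
    by unfold_locales
      (fact tc z ord m a mult ne square_one_SL2[OF two] square_minus_one_conj2[OF two]
        | (use t in \<open>unfold is_torus_gen_def, blast\<close>))+
qed

lemma SL2_torus_4_dvd:
  fixes q defines "q \<equiv> card (UNIV :: 'a::{field,finite} set)"
  assumes odd: "odd q"
  obtains N and t :: "'a::{field,finite} \<times> 'a \<times> 'a \<times> 'a" where "N = q - 1 \<or> N = q + 1" "4 dvd N"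
    "multiplicity 2 (order (SL2 :: ('a \<times> 'a \<times> 'a \<times> 'a) monoid)) = multiplicity 2 N + 1"
    "is_torus_gen t" "group.ord SL2 t = N"
proof -
  let ?G = "SL2 :: ('a \<times> 'a \<times> 'a \<times> 'a) monoid"
  have m: "multiplicity 2 (order ?G) = multiplicity 2 (q - 1) + multiplicity 2 (q + 1)"
    unfolding q_def by (rule multiplicity_order_SL2) (use odd in \<open>auto simp: q_def\<close>)
  have m1: "multiplicity 2 n = 1" if "n mod 4 = 2" for n :: nat
  proof (rule multiplicity_eqI)
    show "2 ^ 1 dvd n" using that by simp presburger
    show "\<not> 2 ^ Suc 1 dvd n" using that by (auto simp: mod_eq_0_iff_dvd[symmetric])
  qed
  obtain r where r: "q = 2 * r + 1" using odd by (rule oddE)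
  show ?thesis
  proof (cases "even r")
    case True
    then obtain k where "r = 2 * k" by (rule evenE)
    then have N: "4 dvd q - 1" "(q + 1) mod 4 = 2" using r by simp_all presburger
    obtain t :: "'a \<times> 'a \<times> 'a \<times> 'a" where "is_torus_gen t" "SL2.ord t = q - 1"
      using split_torus unfolding q_def by blast
    then show ?thesis using that[of "q - 1" t] N m m1[OF N(2)] by simp
  next
    case False
    then obtain k where "r = 2 * k + 1" by (rule oddE)
    then have N: "4 dvd q + 1" "(q - 1) mod 4 = 2" using r by simp_all presburger+
    obtain t :: "'a \<times> 'a \<times> 'a \<times> 'a" where "is_torus_gen t" "SL2.ord t = q + 1"
      using nonsplit_torus unfolding q_def by blast
    then show ?thesis using that[of "q + 1" t] N m m1[OF N(2)] by simp
  qed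
qed

lemma power_two_neighbour_iff:
  fixes q N :: nat
  assumes q2: "2 \<le> q" and N: "N = q - 1 \<or> N = q + 1" "4 dvd N"
  shows "(\<exists>j. N = 2 ^ j) \<longleftrightarrow> (\<exists>k. q + 1 = 2 ^ k \<or> q = 2 ^ k + 1)"
proof
  assume "\<exists>j. N = 2 ^ j"
  then obtain j where "N = 2 ^ j" by blast
  then have "q + 1 = 2 ^ j \<or> q = 2 ^ j + 1" using N(1) q2 by auto
  then show "\<exists>k. q + 1 = 2 ^ k \<or> q = 2 ^ k + 1" by blast
next
  assume "\<exists>k. q + 1 = 2 ^ k \<or> q = 2 ^ k + 1"
  then obtain k where k: "q + 1 = 2 ^ k \<or> q = 2 ^ k + 1" by blast
  obtain n where n: "N = 4 * n" using N(2) by (rule dvdE)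
  show "\<exists>j. N = 2 ^ j"
  proof (cases "k \<ge> 2")
    case True
    then obtain i where "k = 2 + i" using le_Suc_ex by blast
    then have "(2::nat) ^ k = 4 * 2 ^ i" by (simp add: power_add)
    then obtain x where x: "(2::nat) ^ k = 4 * x" by blast
    have "N = 2 ^ k"
    proof (rule ccontr)
      assume "N \<noteq> 2 ^ k"
      then have "4 * n + 2 = 4 * x \<or> 4 * n = 4 * x + 2" using n x k N(1) q2 by auto
      then show False by presburger
    qed
    then show ?thesis by blast
  next
    case False
    then have "k = 0 \<or> k = 1" by auto
    then have "q = 2 \<or> q = 3" using k q2 by auto
    then have "N = 2 ^ 2" using n N(1) by auto
    then show ?thesis by blast
  qed
qed

lemma has_redundant_Sylow_SL2_two_iff:
  fixes q defines "q \<equiv> card (UNIV :: 'a::{field,finite} set)"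
  assumes odd: "odd q"
  shows "has_redundant_Sylow (SL2 :: ('a \<times> 'a \<times> 'a \<times> 'a) monoid) 2 \<longleftrightarrow>
    \<not> (\<exists>k::nat. q + 1 = 2 ^ k \<or> q = 2 ^ k + 1)"
proof -
  let ?G = "SL2 :: ('a \<times> 'a \<times> 'a \<times> 'a) monoid"
  have q2: "q \<ge> 2" unfolding q_def by (rule card_field_ge_2)
  have two: "(2 :: 'a) \<noteq> 0" using two_neq_zero_if_odd_card odd unfolding q_def by blast
  obtain N and t :: "'a \<times> 'a \<times> 'a \<times> 'a" where N: "N = q - 1 \<or> N = q + 1" "4 dvd N"
    "multiplicity 2 (order ?G) = multiplicity 2 N + 1"
    and t: "is_torus_gen t" "group.ord ?G t = N"
    using SL2_torus_4_dvd[where 'a = 'a] odd unfolding q_def by blast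
  have N0: "N \<noteq> 0" using N(1) q2 by auto
  define a where "a = multiplicity 2 N"
  obtain m where m: "N = 2 ^ a * m" "odd m"
    using multiplicity_decompose'[of N 2] N0 unfolding a_def by (metis not_prime_unit two_is_prime_nat)
  have a2: "2 \<le> a" unfolding a_def using N(2) N0 by (intro multiplicity_geI) auto
  have T: "torus_group ?G t (-1, 0, 0, -1) a m"
    by (rule torus_group_SL2[OF two t(1) trans[OF t(2) m(1)] m(2) a2 N(3)[folded a_def]])
  have "has_redundant_Sylow ?G 2 \<longleftrightarrow> m \<noteq> 1"
    using torus_group.redundant[OF T] torus_group.not_redundant[OF T] by (cases "m = 1") simp_all
  also have "m \<noteq> 1 \<longleftrightarrow> \<not> (\<exists>j. N = 2 ^ j)"
  proof (intro iffI notI)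
    assume "m \<noteq> 1" "\<exists>j. N = 2 ^ j"
    then obtain j where "2 ^ j = 2 ^ a * m" using m by auto
    then have "m dvd 2 ^ j" by (metis dvd_triv_right)
    then obtain i where "m = 2 ^ i" using divides_primepow_nat two_is_prime_nat by blast
    then show False using m(2) \<open>m \<noteq> 1\<close> by (cases i) auto
  next
    assume "\<not> (\<exists>j. N = 2 ^ j)" "m = 1"
    then show False using m(1) by simp
  qed
  also have "\<dots> \<longleftrightarrow> \<not> (\<exists>k::nat. q + 1 = 2 ^ k \<or> q = 2 ^ k + 1)"
    using power_two_neighbour_iff[OF q2 N(1,2)] by simp
  finally show ?thesis .
qed

lemma SL2_centre_subgroup: "subgroup SL2_centre (SL2 :: ('a::field \<times> 'a \<times> 'a \<times> 'a) monoid)"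
  by (rule SL2.subgroupI) (auto simp: SL2_centre_def inv_SL2)

lemma SL2_centre_central:
  assumes "k \<in> SL2_centre" "g \<in> carrier (SL2 :: ('a::field \<times> 'a \<times> 'a \<times> 'a) monoid)"
  shows "k \<otimes>\<^bsub>SL2\<^esub> g = g \<otimes>\<^bsub>SL2\<^esub> k"
  using assms by (cases g) (auto simp: SL2_centre_def)

lemma SL2_centre_normal: "SL2_centre \<lhd> (SL2 :: ('a::field \<times> 'a \<times> 'a \<times> 'a) monoid)"
proof (rule SL2.normal_invI[OF SL2_centre_subgroup])
  fix g k :: "'a \<times> 'a \<times> 'a \<times> 'a" assume g: "g \<in> carrier SL2" and k: "k \<in> SL2_centre"
  have kc: "k \<in> carrier SL2" using k by (auto simp: SL2_centre_def)
  have "g \<otimes>\<^bsub>SL2\<^esub> k \<otimes>\<^bsub>SL2\<^esub> inv\<^bsub>SL2\<^esub> g = k"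
    using SL2.conj_commute_iff[OF g kc] SL2_centre_central[OF k g] by simp
  then show "g \<otimes>\<^bsub>SL2\<^esub> k \<otimes>\<^bsub>SL2\<^esub> inv\<^bsub>SL2\<^esub> g \<in> SL2_centre" using k by simp
qed

lemma has_redundant_Sylow_PSL2_iff:
  fixes p :: nat
  assumes p: "prime p"
    and imp: "has_redundant_Sylow (SL2 :: ('a::{field,finite} \<times> 'a \<times> 'a \<times> 'a) monoid) p \<Longrightarrow> p = 2"
  shows "has_redundant_Sylow (PSL2 :: ('a \<times> 'a \<times> 'a \<times> 'a) set monoid) p \<longleftrightarrow>
     has_redundant_Sylow (SL2 :: ('a \<times> 'a \<times> 'a \<times> 'a) monoid) p"
proof -
  let ?G = "SL2 :: ('a \<times> 'a \<times> 'a \<times> 'a) monoid" and ?H = "PSL2 :: ('a \<times> 'a \<times> 'a \<times> 'a) set monoid"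
  let ?Z = "SL2_centre :: ('a \<times> 'a \<times> 'a \<times> 'a) set"
  let ?h = "\<lambda>x. ?Z #>\<^bsub>?G\<^esub> x"
  have ker: "kernel ?G ?H ?h = ?Z"
  proof (intro equalityI subsetI)
    fix x assume "x \<in> kernel ?G ?H ?h"
    then have "x \<in> carrier ?G" "?Z #>\<^bsub>?G\<^esub> x = ?Z" by (auto simp: kernel_def PSL2_def)
    then show "x \<in> ?Z" using SL2.rcos_self[OF _ SL2_centre_subgroup] by metis
  next
    fix x assume x: "x \<in> ?Z"
    then show "x \<in> kernel ?G ?H ?h"
      using SL2.coset_join2[OF _ SL2_centre_subgroup x] subgroup.mem_carrier[OF SL2_centre_subgroup x]
      by (simp add: kernel_def PSL2_def)
  qed
  have "group ?H" unfolding PSL2_def by (rule normal.factorgroup_is_group[OF SL2_centre_normal])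
  moreover have "?h \<in> hom ?G ?H" unfolding PSL2_def by (rule normal.r_coset_hom_Mod[OF SL2_centre_normal])
  ultimately have hom: "group_hom ?G ?H ?h"
    by (intro group_hom.intro group_SL2 group_hom_axioms.intro)
  have fin: "finite_group_prime ?G p"
    by (intro finite_group_prime.intro group_SL2 finite_group_prime_axioms.intro finite_SL2 p)
  have surj: "?h ` carrier ?G = carrier ?H" by (simp add: PSL2_def carrier_FactGroup)
  interpret central_epi ?G ?H ?h p
    by (intro central_epi.intro central_epi_axioms.intro hom fin surj) (unfold ker, rule SL2_centre_central)
  have Z: "card ?Z = 1 \<or> card ?Z = 2"
    unfolding SL2_centre_def by (auto simp: card_insert_if)
  show ?thesis
  proof (cases "p = 2")
    case True
    then obtain b where b: "card (kernel ?G ?H ?h) = p ^ b" using Z ker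
      by (metis power_0 power_one_right)
    then show ?thesis using redundant_image[OF b] not_redundant_image by blast
  next
    case False
    then have "\<not> p dvd card ?Z" using Z p by (metis not_prime_unit primes_dvd_imp_eq two_is_prime_nat)
    then show ?thesis using not_redundant_image imp False ker by metis
  qed
qed

theorem theoremD:
  fixes p :: nat
  assumes "prime p"
  shows "(has_redundant_Sylow (SL2 :: ('a::{field,finite} * 'a * 'a * 'a) monoid) p \<longleftrightarrow>
            p = 2 \<and> \<not> (\<exists>k::nat. int (card (UNIV :: 'a set)) = 2 ^ k - 1 \<or> int (card (UNIV :: 'a set)) = 2 ^ k
                                  \<or> int (card (UNIV :: 'a set)) = 2 ^ k + 1))
       \<and> (has_redundant_Sylow (PSL2 :: ('a * 'a * 'a * 'a) set monoid) p \<longleftrightarrow>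
            p = 2 \<and> \<not> (\<exists>k::nat. int (card (UNIV :: 'a set)) = 2 ^ k - 1 \<or> int (card (UNIV :: 'a set)) = 2 ^ k
                                  \<or> int (card (UNIV :: 'a set)) = 2 ^ k + 1))"
proof -
  let ?G = "SL2 :: ('a * 'a * 'a * 'a) monoid"
  define q where "q = card (UNIV :: 'a set)"
  have q2: "q \<ge> 2" unfolding q_def by (rule card_field_ge_2)
  have pow: "(2::int) ^ k = int (2 ^ k)" for k by simp
  have int1: "int q = 2 ^ k - 1 \<longleftrightarrow> q + 1 = 2 ^ k" for k unfolding pow by linarith
  have int2: "int q = 2 ^ k \<longleftrightarrow> q = 2 ^ k" for k unfolding pow by linarith
  have int3: "int q = 2 ^ k + 1 \<longleftrightarrow> q = 2 ^ k + 1" for k unfolding pow by linarith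
  have SL: "has_redundant_Sylow ?G p \<longleftrightarrow>
     p = 2 \<and> \<not> (\<exists>k::nat. q + 1 = 2 ^ k \<or> q = 2 ^ k \<or> q = 2 ^ k + 1)"
  proof (cases "p dvd q")
    case True
    then show ?thesis
      using not_redundant_SL2_char[OF assms, where 'a = 'a] card_field_prime_power[OF assms, where 'a = 'a]
      unfolding q_def by auto
  next
    case nd: False
    show ?thesis
    proof (cases "p = 2")
      case True
      then have "odd q" using nd by simp
      moreover have "q \<noteq> 2 ^ k" for k using \<open>odd q\<close> q2 by (cases k) auto
      ultimately show ?thesis using has_redundant_Sylow_SL2_two_iff[where 'a = 'a] True unfolding q_def by blast
    next
      case False
      then have "odd p" using assms primes_dvd_imp_eq two_is_prime_nat by blast
      then show ?thesis using not_redundant_SL2_odd[OF assms, where 'a = 'a] nd False unfolding q_def by blast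
    qed
  qed
  then show ?thesis
    using has_redundant_Sylow_PSL2_iff[OF assms, where 'a = 'a]
    unfolding q_def[symmetric] int1 int2 int3 by blast
qed

end
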